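(* Let $K$ be a field and $\mathbf A=\operatorname{Alg}(v_0,v_1)\subset\operatorname{End}\Lambda$. Consider the set $\mathcal B$ of monomials $$\{v_0,\ v_1v_0^{*}\}\ \cup\ \{x_0^{\xi_0}x_1^{\xi_1}v_2v_1^{*}v_0^{*}\mid \xi_0,\xi_1\in\{0,1\},\ \xi_0+\xi_1\le 1\}$$ $$\cup\ \bigcup_{n=3}^\infty\{r_{n-3}x_{n-2}^{\xi_{n-2}}x_{n-1}^{\xi_{n-1}}v_nv_{n-1}^{\alpha_{n-1}}v_{n-2}^{\alpha_{n-2}}\cdots v_0^{\alpha_0}\mid \xi_i,\alpha_i\in\{0,1\},\ \xi_{n-2}+\xi_{n-1}\le 1+\alpha_{n-1}\},$$ where $r_{n-3}$ runs over all tail monomials, $b^{*}$ denotes all $b^{\alpha}$ with $\alpha\in\{0,1\}$, and where for $n=3$ it is additionally assumed that the only monomials included which contain both $x_0$ and $x_2$ are those of the form $x_0x_2v_3v_2v_1^{*}v_0^{*}$. Then: (i) if $\operatorname{char}K\ne 2$, then $\mathcal B$ is a basis of $\mathbf A$; (ii) if $\operatorname{char}K=2$, then $\mathbf A$ is contained in the linear span of $\mathcal B$; (iii) over any field $K$, the monomials of $\mathcal B$ with $\xi_{n-1}=0$ (where $v_n$ is the pivot element of largest index in the monomial) are linearly independent and belong to $\mathbf A$.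
   Context: Let $\Lambda=\Lambda(x_i\mid i\ge 0)$ be the Grassmann (exterior) algebra over $K$ on odd generators $x_0,x_1,\dots$ ($x_ix_j=-x_jx_i$, $x_i^2=0$), a $\mathbb Z_2$-graded algebra. In $\operatorname{End}\Lambda$ identify $x_i$ with left multiplication by $x_i$, and let $\partial_i$ be the odd superderivation of $\Lambda$ with $\partial_i(x_j)=\delta_{ij}$ (so $\partial_i(ab)=\partial_i(a)b+(-1)^{\deg a}a\,\partial_i(b)$). The pivot elements are the odd superderivations $$v_i=\partial_i+x_ix_{i+1}(\partial_{i+2}+x_{i+2}x_{i+3}(\partial_{i+4}+\cdots)),\quad i\ge 0,$$ that is, $v_i=\partial_i+x_ix_{i+1}v_{i+2}$ (well defined on $\Lambda$, since each element involves finitely many letters). $\mathbf A=\operatorname{Alg}(v_0,v_1)$ is the associative subalgebra (without unit) of $\operatorname{End}\Lambda$ generated by $v_0,v_1$. A tail monomial is $r_m=x_0^{\xi_0}\cdots x_m^{\xi_m}$, $\xi_i\in\{0,1\}$. Products of letters are compositions of operators. *)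

theory Defs
  imports Complex_Main "HOL-Library.Function_Algebras" "HOL-Library.Groups_Big_Fun"
begin

section \<open>The Grassmann algebra\<close>

text \<open>
  An element of \<open>\<Lambda>(x\<^sub>0, x\<^sub>1, \<dots>)\<close> is stored as its family of coefficients with respect to the
  monomials \<open>x\<^sub>S = x\<^sub>s\<^sub>1 x\<^sub>s\<^sub>2 \<dots> x\<^sub>s\<^sub>k\<close>, where \<open>S = {s\<^sub>1 < s\<^sub>2 < \<dots> < s\<^sub>k}\<close> runs over the finite sets of
  indices.
\<close>

typedef (overloaded) ('k::zero) grassmann =
    "{f :: nat set \<Rightarrow> 'k. finite {S. f S \<noteq> 0} \<and> (\<forall>S. f S \<noteq> 0 \<longrightarrow> finite S)}"
  morphisms gcoeff Abs_grassmann
  by (rule exI[of _ "\<lambda>_. 0"]) simp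

setup_lifting type_definition_grassmann

lemma finite_gcoeff: "finite {S. gcoeff a S \<noteq> 0}"
  using gcoeff[of a] by simp

lemma gcoeff_infinite: "infinite S \<Longrightarrow> gcoeff a S = 0"
  using gcoeff[of a] by auto

lemma grassmann_eqI: "(\<And>S. finite S \<Longrightarrow> gcoeff a S = gcoeff b S) \<Longrightarrow> a = b"
  by (metis gcoeff_infinite gcoeff_inject ext)

text \<open>
  For disjoint \<open>S\<close> and \<open>T\<close> we have \<open>x\<^sub>S x\<^sub>T = \<epsilon> S T \<cdot> x\<^sub>S\<^sub>\<union>\<^sub>T\<close>: sorting the letters transposes exactly the
  pairs counted here, and each transposition changes the sign.
\<close>

definition crossings :: "nat set \<Rightarrow> nat set \<Rightarrow> nat" where
  "crossings S T = card {(s, t). s \<in> S \<and> t \<in> T \<and> t < s}"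

definition gsign :: "nat set \<Rightarrow> nat set \<Rightarrow> 'k::ring_1" (\<open>\<epsilon>\<close>) where
  "\<epsilon> S T = (-1) ^ crossings S T"

instantiation grassmann :: (field) ring_1
begin

lift_definition zero_grassmann :: "'a grassmann" is "\<lambda>_. 0"
  by simp

lift_definition plus_grassmann :: "'a grassmann \<Rightarrow> 'a grassmann \<Rightarrow> 'a grassmann"
  is "\<lambda>f g S. f S + g S"
proof (intro conjI allI impI)
  fix f g :: "nat set \<Rightarrow> 'a" and S
  assume A: "finite {S. f S \<noteq> 0} \<and> (\<forall>S. f S \<noteq> 0 \<longrightarrow> finite S)"
    "finite {S. g S \<noteq> 0} \<and> (\<forall>S. g S \<noteq> 0 \<longrightarrow> finite S)"
  show "finite {S. f S + g S \<noteq> 0}"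
    by (rule finite_subset[of _ "{S. f S \<noteq> 0} \<union> {S. g S \<noteq> 0}"]) (use A in auto)
  show "f S + g S \<noteq> 0 \<Longrightarrow> finite S"
    using A by (cases "f S = 0") auto
qed

lift_definition uminus_grassmann :: "'a grassmann \<Rightarrow> 'a grassmann" is "\<lambda>f S. - f S"
  by simp

lift_definition minus_grassmann :: "'a grassmann \<Rightarrow> 'a grassmann \<Rightarrow> 'a grassmann"
  is "\<lambda>f g S. f S - g S"
proof (intro conjI allI impI)
  fix f g :: "nat set \<Rightarrow> 'a" and S
  assume A: "finite {S. f S \<noteq> 0} \<and> (\<forall>S. f S \<noteq> 0 \<longrightarrow> finite S)"
    "finite {S. g S \<noteq> 0} \<and> (\<forall>S. g S \<noteq> 0 \<longrightarrow> finite S)"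
  show "finite {S. f S - g S \<noteq> 0}"
    by (rule finite_subset[of _ "{S. f S \<noteq> 0} \<union> {S. g S \<noteq> 0}"]) (use A in auto)
  show "f S - g S \<noteq> 0 \<Longrightarrow> finite S"
    using A by (cases "f S = 0") auto
qed

lift_definition one_grassmann :: "'a grassmann" is "\<lambda>S. if S = {} then 1 else 0"
  by simp

lift_definition times_grassmann :: "'a grassmann \<Rightarrow> 'a grassmann \<Rightarrow> 'a grassmann"
  is "\<lambda>f g S. \<Sum>T\<in>Pow S. \<epsilon> T (S - T) * f T * g (S - T)"
proof (intro conjI allI impI)
  fix f g :: "nat set \<Rightarrow> 'a" and S
  assume A: "finite {S. f S \<noteq> 0} \<and> (\<forall>S. f S \<noteq> 0 \<longrightarrow> finite S)"
    "finite {S. g S \<noteq> 0} \<and> (\<forall>S. g S \<noteq> 0 \<longrightarrow> finite S)"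
  have *: "\<exists>T\<in>Pow S. f T \<noteq> 0 \<and> g (S - T) \<noteq> 0"
    if "(\<Sum>T\<in>Pow S. \<epsilon> T (S - T) * f T * g (S - T)) \<noteq> 0" for S
  proof (rule ccontr)
    assume "\<not> ?thesis"
    then have "(\<Sum>T\<in>Pow S. \<epsilon> T (S - T) * f T * g (S - T)) = 0"
      by (intro sum.neutral) auto
    with that show False by simp
  qed
  have "{S. (\<Sum>T\<in>Pow S. \<epsilon> T (S - T) * f T * g (S - T)) \<noteq> 0}
      \<subseteq> (\<lambda>(T, U). T \<union> U) ` ({S. f S \<noteq> 0} \<times> {S. g S \<noteq> 0})"
  proof
    fix S assume "S \<in> {S. (\<Sum>T\<in>Pow S. \<epsilon> T (S - T) * f T * g (S - T)) \<noteq> 0}"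
    then obtain T where T: "T \<subseteq> S" "f T \<noteq> 0" "g (S - T) \<noteq> 0"
      using *[of S] by auto
    then have "S = (\<lambda>(T, U). T \<union> U) (T, S - T)" by auto
    with T show "S \<in> (\<lambda>(T, U). T \<union> U) ` ({S. f S \<noteq> 0} \<times> {S. g S \<noteq> 0})"
      by blast
  qed
  then show "finite {S. (\<Sum>T\<in>Pow S. \<epsilon> T (S - T) * f T * g (S - T)) \<noteq> 0}"
    by (rule finite_subset) (use A in auto)
  assume "(\<Sum>T\<in>Pow S. \<epsilon> T (S - T) * f T * g (S - T)) \<noteq> 0"
  then have "finite (Pow S)"
    using sum.infinite by blast
  then show "finite S"
    by simp
qed

lemma crossings_empty: "crossings {} T = 0" "crossings S {} = 0"
  by (auto simp: crossings_def)

lemma finite_crossings: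
  "finite S \<Longrightarrow> finite T \<Longrightarrow> finite {(s, t). s \<in> S \<and> t \<in> T \<and> t < (s::nat)}"
  by (rule finite_subset[of _ "S \<times> T"]) auto

lemma crossings_Un_left:
  assumes "finite S" "finite S'" "finite T" "S \<inter> S' = {}"
  shows "crossings (S \<union> S') T = crossings S T + crossings S' T"
proof -
  have "{(s, t). s \<in> S \<union> S' \<and> t \<in> T \<and> t < s}
      = {(s, t). s \<in> S \<and> t \<in> T \<and> t < s} \<union> {(s, t). s \<in> S' \<and> t \<in> T \<and> t < s}"
    by auto
  then show ?thesis
    unfolding crossings_def using assms by (auto intro!: card_Un_disjoint finite_crossings)
qed

lemma crossings_Un_right:
  assumes "finite S" "finite T" "finite T'" "T \<inter> T' = {}"
  shows "crossings S (T \<union> T') = crossings S T + crossings S T'"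
proof -
  have "{(s, t). s \<in> S \<and> t \<in> T \<union> T' \<and> t < s}
      = {(s, t). s \<in> S \<and> t \<in> T \<and> t < s} \<union> {(s, t). s \<in> S \<and> t \<in> T' \<and> t < s}"
    by auto
  then show ?thesis
    unfolding crossings_def using assms by (auto intro!: card_Un_disjoint finite_crossings)
qed

lemma gsign_empty: "\<epsilon> {} T = (1 :: 'k::ring_1)" "\<epsilon> S {} = (1 :: 'k)"
  by (auto simp: gsign_def crossings_empty)

lemma gsign_Un_left:
  assumes "finite S" "finite S'" "finite T" "S \<inter> S' = {}"
  shows "\<epsilon> (S \<union> S') T = (\<epsilon> S T * \<epsilon> S' T :: 'k::ring_1)"
  using crossings_Un_left[OF assms] by (simp add: gsign_def power_add)

lemma gsign_Un_right:
  assumes "finite S" "finite T" "finite T'" "T \<inter> T' = {}"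
  shows "\<epsilon> S (T \<union> T') = (\<epsilon> S T * \<epsilon> S T' :: 'k::ring_1)"
  using crossings_Un_right[OF assms] by (simp add: gsign_def power_add)

lemma grassmann_assoc:
  fixes a b c :: "'a grassmann"
  shows "a * b * c = a * (b * c)"
proof (rule grassmann_eqI)
  fix S :: "nat set" assume S: "finite S"
  have fin: "finite T" if "T \<subseteq> S" for T
    using that S by (rule finite_subset)
  define h where "h = (\<lambda>T U. (\<epsilon> T U * \<epsilon> T (S - T - U) * \<epsilon> U (S - T - U)) *
    (gcoeff a T * gcoeff b U * gcoeff c (S - T - U)))"
  have "gcoeff (a * b * c) S = (\<Sum>T\<in>Pow S. \<Sum>U\<in>Pow T.
      \<epsilon> T (S - T) * (\<epsilon> U (T - U) * gcoeff a U * gcoeff b (T - U)) * gcoeff c (S - T))"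
    by (simp add: times_grassmann.rep_eq sum_distrib_left sum_distrib_right)
  also have "\<dots> = (\<Sum>T\<in>Pow S. \<Sum>U\<in>Pow T. h U (T - U))"
  proof (intro sum.cong refl)
    fix T U assume TU: "T \<in> Pow S" "U \<in> Pow T"
    then have "finite U" "finite (T - U)" "finite (S - T)" "U \<union> (T - U) = T"
      by (auto intro!: finite_subset[OF _ S])
    then have "\<epsilon> T (S - T) = (\<epsilon> U (S - T) * \<epsilon> (T - U) (S - T) :: 'a)"
      by (metis gsign_Un_left Diff_disjoint)
    moreover have "S - U - (T - U) = S - T"
      using TU by auto
    ultimately show "\<epsilon> T (S - T) * (\<epsilon> U (T - U) * gcoeff a U * gcoeff b (T - U)) * gcoeff c (S - T)
      = h U (T - U)"
      by (simp add: h_def mult_ac)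
  qed
  also have "\<dots> = (\<Sum>(T, U)\<in>Sigma (Pow S) Pow. h U (T - U))"
    by (rule sum.Sigma) (use S fin in auto)
  also have "\<dots> = (\<Sum>(T, U)\<in>(SIGMA T:Pow S. Pow (S - T)). h T U)"
    by (rule sum.reindex_bij_witness[of _ "\<lambda>(T, U). (T \<union> U, T)" "\<lambda>(T, U). (U, T - U)"])
       (auto simp: Un_Diff)
  also have "\<dots> = (\<Sum>T\<in>Pow S. \<Sum>U\<in>Pow (S - T). h T U)"
    by (rule sum.Sigma[symmetric]) (use S fin in auto)
  also have "\<dots> = (\<Sum>T\<in>Pow S. \<Sum>U\<in>Pow (S - T). \<epsilon> T (S - T) * gcoeff a T *
      (\<epsilon> U (S - T - U) * gcoeff b U * gcoeff c (S - T - U)))"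
  proof (intro sum.cong refl)
    fix T U assume TU: "T \<in> Pow S" "U \<in> Pow (S - T)"
    then have "finite T" "finite U" "finite (S - T - U)" "U \<union> (S - T - U) = S - T"
      by (auto intro!: finite_subset[OF _ S])
    then have "\<epsilon> T (S - T) = (\<epsilon> T U * \<epsilon> T (S - T - U) :: 'a)"
      by (metis gsign_Un_right Diff_disjoint)
    then show "h T U = \<epsilon> T (S - T) * gcoeff a T *
      (\<epsilon> U (S - T - U) * gcoeff b U * gcoeff c (S - T - U))"
      by (simp add: h_def mult_ac)
  qed
  also have "\<dots> = gcoeff (a * (b * c)) S"
    by (simp add: times_grassmann.rep_eq sum_distrib_left)
  finally show "gcoeff (a * b * c) S = gcoeff (a * (b * c)) S" .
qed

instance
proof
  fix a b c :: "'a grassmann"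
  show "a * b * c = a * (b * c)"
    by (rule grassmann_assoc)
  show "1 * a = a"
  proof (rule grassmann_eqI)
    fix S :: "nat set" assume S: "finite S"
    have "gcoeff (1 * a) S = (\<Sum>T\<in>Pow S. if T = {} then gcoeff a S else 0)"
      unfolding times_grassmann.rep_eq one_grassmann.rep_eq
      by (intro sum.cong) (auto simp: gsign_empty)
    then show "gcoeff (1 * a) S = gcoeff a S" using S by simp
  qed
  show "a * 1 = a"
  proof (rule grassmann_eqI)
    fix S :: "nat set" assume S: "finite S"
    have "gcoeff (a * 1) S = (\<Sum>T\<in>Pow S. if T = S then gcoeff a S else 0)"
      unfolding times_grassmann.rep_eq one_grassmann.rep_eq
      by (intro sum.cong) (auto simp: gsign_empty)
    then show "gcoeff (a * 1) S = gcoeff a S" using S by simp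
  qed
  show "(a + b) * c = a * c + b * c" "a * (b + c) = a * b + a * c"
    by (rule grassmann_eqI,
        simp add: times_grassmann.rep_eq plus_grassmann.rep_eq algebra_simps sum.distrib)+
  show "(0 :: 'a grassmann) \<noteq> 1"
  proof
    assume "(0 :: 'a grassmann) = 1"
    then have "gcoeff (0 :: 'a grassmann) {} = gcoeff 1 {}" by simp
    then show False by (simp add: zero_grassmann.rep_eq one_grassmann.rep_eq)
  qed
  show "a + b + c = a + (b + c)"
    by (rule grassmann_eqI) (simp add: plus_grassmann.rep_eq add.assoc)
  show "a + b = b + a"
    by (rule grassmann_eqI) (simp add: plus_grassmann.rep_eq add.commute)
  show "0 + a = a"
    by (rule grassmann_eqI) (simp add: plus_grassmann.rep_eq zero_grassmann.rep_eq)
  show "- a + a = 0"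
    by (rule grassmann_eqI)
       (simp add: plus_grassmann.rep_eq zero_grassmann.rep_eq uminus_grassmann.rep_eq)
  show "a - b = a + - b"
    by (rule grassmann_eqI)
       (simp add: plus_grassmann.rep_eq minus_grassmann.rep_eq uminus_grassmann.rep_eq)
qed

end

lift_definition gscale :: "'k::field \<Rightarrow> 'k grassmann \<Rightarrow> 'k grassmann" (infixr \<open>*\<^sub>\<Lambda>\<close> 75)
  is "\<lambda>c f S. c * f S"
proof (intro conjI allI impI)
  fix c :: 'k and f :: "nat set \<Rightarrow> 'k" and S
  assume A: "finite {S. f S \<noteq> 0} \<and> (\<forall>S. f S \<noteq> 0 \<longrightarrow> finite S)"
  then show "finite {S. c * f S \<noteq> 0}"
    by (auto elim: rev_finite_subset)
  show "c * f S \<noteq> 0 \<Longrightarrow> finite S"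
    using A by auto
qed

lemmas gcoeff_simps = zero_grassmann.rep_eq plus_grassmann.rep_eq minus_grassmann.rep_eq
  uminus_grassmann.rep_eq gscale.rep_eq

interpretation \<Lambda>: vector_space "gscale :: 'k::field \<Rightarrow> 'k grassmann \<Rightarrow> 'k grassmann"
  by standard (rule grassmann_eqI; simp add: gcoeff_simps algebra_simps)+

lemma gscale_mult: "(c *\<^sub>\<Lambda> a) * b = c *\<^sub>\<Lambda> (a * b)" "a * (c *\<^sub>\<Lambda> b) = c *\<^sub>\<Lambda> (a * b)"
  by (rule grassmann_eqI; simp add: times_grassmann.rep_eq gcoeff_simps sum_distrib_left mult_ac)+

text \<open>\<open>gmon S\<close> is \<open>x\<^sub>S\<close> for finite \<open>S\<close>; see \<open>gmon_eq_prod\<close> below.\<close>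

lift_definition gmon :: "nat set \<Rightarrow> 'k::field grassmann"
  is "\<lambda>S T. if T = S \<and> finite S then 1 else 0"
  by (auto simp: if_distrib cong: if_cong)

definition letter :: "nat \<Rightarrow> 'k::field grassmann" where
  "letter i = gmon {i}"

lemma gmon_empty: "gmon {} = 1"
  by (rule grassmann_eqI) (simp add: gmon.rep_eq one_grassmann.rep_eq)

lemma gmon_times:
  assumes "finite S" "finite T"
  shows "gmon S * gmon T = (if S \<inter> T = {} then \<epsilon> S T *\<^sub>\<Lambda> gmon (S \<union> T) else (0 :: 'k::field grassmann))"
proof (rule grassmann_eqI)
  fix U :: "nat set" assume U: "finite U"
  have "gcoeff (gmon S * gmon T :: 'k grassmann) U
      = (\<Sum>V\<in>Pow U. if V = S then (if U - S = T then \<epsilon> S T else 0) else 0)"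
    unfolding times_grassmann.rep_eq gmon.rep_eq by (intro sum.cong) (use assms in auto)
  also have "\<dots> = (if S \<subseteq> U \<and> U - S = T then \<epsilon> S T else 0)"
    using U by simp
  also have "\<dots> = gcoeff (if S \<inter> T = {} then \<epsilon> S T *\<^sub>\<Lambda> gmon (S \<union> T) else (0 :: 'k grassmann)) U"
    using assms by (auto simp: gcoeff_simps gmon.rep_eq)
  finally show "gcoeff (gmon S * gmon T :: 'k grassmann) U
    = gcoeff (if S \<inter> T = {} then \<epsilon> S T *\<^sub>\<Lambda> gmon (S \<union> T) else (0 :: 'k grassmann)) U" .
qed

lemma gmon_insert:
  assumes "finite S" "\<And>s. s \<in> S \<Longrightarrow> i < s"
  shows "gmon (insert i S) = letter i * gmon S"
proof -
  have "{(s, t). s \<in> {i} \<and> t \<in> S \<and> t < s} = {}" using assms by fastforce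
  then have "\<epsilon> {i} S = (1 :: 'a)" unfolding gsign_def crossings_def by (metis card.empty power_0)
  then show ?thesis using assms by (auto simp: letter_def gmon_times)
qed

lemma gmon_eq_prod:
  assumes "finite S"
  shows "gmon S = prod_list (map letter (sorted_list_of_set S))"
proof -
  have "gmon (set xs) = prod_list (map letter xs)" if "sorted_wrt (<) xs" for xs
    using that by (induction xs) (auto simp: gmon_empty gmon_insert)
  from this[of "sorted_list_of_set S"] assms show ?thesis by simp
qed

lemma grassmann_expand: "a = (\<Sum>S | gcoeff a S \<noteq> 0. gcoeff a S *\<^sub>\<Lambda> gmon S)"
proof (rule grassmann_eqI)
  fix T :: "nat set" assume T: "finite T"
  have gcoeff_sum: "gcoeff (sum f A) T = (\<Sum>x\<in>A. gcoeff (f x) T)" for f :: "nat set \<Rightarrow> 'a grassmann" and A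
    by (induction A rule: infinite_finite_induct) (auto simp: gcoeff_simps)
  have "gcoeff (\<Sum>S | gcoeff a S \<noteq> 0. gcoeff a S *\<^sub>\<Lambda> gmon S) T
      = (\<Sum>S | gcoeff a S \<noteq> 0. if S = T then gcoeff a T else 0)"
    unfolding gcoeff_sum gcoeff_simps gmon.rep_eq using T by (intro sum.cong) auto
  also have "\<dots> = gcoeff a T"
    using finite_gcoeff[of a] by simp
  finally show "gcoeff a T = gcoeff (\<Sum>S | gcoeff a S \<noteq> 0. gcoeff a S *\<^sub>\<Lambda> gmon S) T" by simp
qed

lemma letter_square: "letter i * letter i = 0"
  by (simp add: letter_def gmon_times)

lemma letter_anticommute: "letter i * letter j = - (letter j * letter i)"
proof -
  have "crossings {i} {j} = (if j < i then 1 else 0)" for i j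
  proof -
    have "{(s, t). s \<in> {i} \<and> t \<in> {j} \<and> t < s} = (if j < i then {(i, j)} else {})" by auto
    then show ?thesis unfolding crossings_def by simp
  qed
  then show ?thesis
    by (cases i j rule: linorder_cases)
       (auto simp: letter_def gmon_times gsign_def insert_commute)
qed


section \<open>Superderivations\<close>

definition homogeneous_part :: "nat \<Rightarrow> 'k::field grassmann set" where
  "homogeneous_part d = {a. \<forall>S. gcoeff a S \<noteq> 0 \<longrightarrow> card S mod 2 = d}"

type_synonym 'k operator = "'k grassmann \<Rightarrow> 'k grassmann"

abbreviation End\<Lambda> :: "'k::field operator set" where
  "End\<Lambda> \<equiv> {f. Vector_Spaces.linear gscale gscale f}"

definition odd_superderivation :: "'k::field operator \<Rightarrow> bool" where
  "odd_superderivation D \<longleftrightarrow> D \<in> End\<Lambda> \<and>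
    D ` homogeneous_part 0 \<subseteq> homogeneous_part 1 \<and> D ` homogeneous_part 1 \<subseteq> homogeneous_part 0 \<and>
    (\<forall>d\<in>{0, 1}. \<forall>a\<in>homogeneous_part d. \<forall>b. D (a * b) = D a * b + (-1) ^ d * a * D b)"

definition partial :: "nat \<Rightarrow> 'k::field operator" (\<open>\<partial>\<close>) where
  "\<partial> i = (THE D. odd_superderivation D \<and> (\<forall>j. D (letter j) = (if i = j then 1 else 0)))"

lemma superderivation_ext:
  fixes D E :: "'a::field grassmann \<Rightarrow> 'a grassmann"
  assumes D: "odd_superderivation D" and E: "odd_superderivation E"
    and eq: "\<And>j. D (letter j) = E (letter j)"
  shows "D = E"
proof
  fix a :: "'a grassmann"
  interpret D: Vector_Spaces.linear gscale gscale D
    using D by (simp add: odd_superderivation_def)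
  interpret E: Vector_Spaces.linear gscale gscale E
    using E by (simp add: odd_superderivation_def)
  have one: "F 1 = 0" if "odd_superderivation F" for F :: "'a grassmann \<Rightarrow> 'a grassmann"
  proof -
    have "(1 :: 'a grassmann) \<in> homogeneous_part 0"
      by (auto simp: homogeneous_part_def one_grassmann.rep_eq)
    with that have "F (1 * 1) = F 1 * 1 + (-1) ^ 0 * 1 * F 1"
      unfolding odd_superderivation_def by blast
    then show ?thesis by simp
  qed
  have leibniz: "F (letter j * b) = F (letter j) * b - letter j * F b"
    if "odd_superderivation F" for F :: "'a grassmann \<Rightarrow> 'a grassmann" and j b
  proof -
    have "(letter j :: 'a grassmann) \<in> homogeneous_part 1"
      by (auto simp: homogeneous_part_def letter_def gmon.rep_eq)
    with that have "F (letter j * b) = F (letter j) * b + (-1) ^ 1 * letter j * F b"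
      unfolding odd_superderivation_def by blast
    then show ?thesis by simp
  qed
  have "D (prod_list (map letter js)) = E (prod_list (map letter js))" for js
    by (induction js) (simp_all add: one[OF D] one[OF E] leibniz[OF D] leibniz[OF E] eq)
  then have "D (gmon S) = E (gmon S)" if "gcoeff a S \<noteq> 0" for S
    using gcoeff_infinite[of S a] that by (cases "finite S") (auto simp: gmon_eq_prod)
  then have "D (\<Sum>S | gcoeff a S \<noteq> 0. gcoeff a S *\<^sub>\<Lambda> gmon S) =
      E (\<Sum>S | gcoeff a S \<noteq> 0. gcoeff a S *\<^sub>\<Lambda> gmon S)"
    by (simp add: D.sum E.sum D.scale E.scale)
  then show "D a = E a"
    by (simp flip: grassmann_expand)
qed

lift_definition contraction :: "nat \<Rightarrow> 'k::field operator"
  is "\<lambda>i f S. if i \<in> S then 0 else \<epsilon> {i} S * f (insert i S)"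
proof (intro conjI allI impI)
  fix i and f :: "nat set \<Rightarrow> 'k" and S
  assume A: "finite {S. f S \<noteq> 0} \<and> (\<forall>S. f S \<noteq> 0 \<longrightarrow> finite S)"
  have "{S. (if i \<in> S then 0 else \<epsilon> {i} S * f (insert i S)) \<noteq> 0} \<subseteq> (\<lambda>S. S - {i}) ` {S. f S \<noteq> 0}"
  proof
    fix S assume "S \<in> {S. (if i \<in> S then 0 else \<epsilon> {i} S * f (insert i S)) \<noteq> 0}"
    then have "S = insert i S - {i}" "f (insert i S) \<noteq> 0"
      by (auto split: if_splits)
    then show "S \<in> (\<lambda>S. S - {i}) ` {S. f S \<noteq> 0}" by blast
  qed
  then show "finite {S. (if i \<in> S then 0 else \<epsilon> {i} S * f (insert i S)) \<noteq> 0}"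
    by (rule finite_subset) (use A in auto)
  assume "(if i \<in> S then 0 else \<epsilon> {i} S * f (insert i S)) \<noteq> 0"
  then have "f (insert i S) \<noteq> 0" by (auto split: if_splits)
  then show "finite S" using A by (metis finite_insert)
qed

lemma crossings_swap:
  assumes "finite T" "i \<notin> T"
  shows "crossings T {i} + crossings {i} T = card T"
proof -
  have "crossings T {i} = card {t \<in> T. i < t}"
    unfolding crossings_def by (rule bij_betw_same_card[of fst], rule bij_betw_byWitness[where f' = "\<lambda>t. (t, i)"]) auto
  moreover have "crossings {i} T = card {t \<in> T. t < i}"
    unfolding crossings_def by (rule bij_betw_same_card[of snd], rule bij_betw_byWitness[where f' = "\<lambda>t. (i, t)"]) auto
  moreover have "card ({t \<in> T. i < t} \<union> {t \<in> T. t < i}) = card {t \<in> T. i < t} + card {t \<in> T. t < i}"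
    by (rule card_Un_disjoint) (use assms in auto)
  moreover have "{t \<in> T. i < t} \<union> {t \<in> T. t < i} = T"
    using assms by (auto simp: not_less intro: le_neq_trans)
  ultimately show ?thesis by simp
qed

lemma gsign_swap:
  assumes "finite T" "i \<notin> T"
  shows "\<epsilon> T {i} * \<epsilon> {i} T = ((-1) ^ card T :: 'k::ring_1)"
  using crossings_swap[OF assms] by (simp add: gsign_def flip: power_add)

lemma gsign_square: "\<epsilon> S T * \<epsilon> S T = (1 :: 'k::ring_1)"
  by (simp add: gsign_def flip: power_add mult_2 power_mult)

lemma minus_one_power_parity: "(-1 :: 'k::ring_1) ^ n = (-1) ^ (n mod 2)"
  by (cases "even n") (auto simp: odd_iff_mod_2_eq_one even_iff_mod_2_eq_zero)

lemma gcoeff_signed: "gcoeff ((-1) ^ d * a) S = (-1) ^ d * gcoeff a S"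
  by (induction d) (simp_all add: gcoeff_simps)

lemma contraction_leibniz:
  fixes a b :: "'k::field grassmann"
  assumes a: "a \<in> homogeneous_part d" "d \<in> {0, 1}"
  shows "contraction i (a * b) = contraction i a * b + (-1) ^ d * a * contraction i b"
proof (rule grassmann_eqI)
  fix S :: "nat set" assume S: "finite S"
  have fin: "finite T" if "T \<subseteq> S" for T
    using that S by (rule finite_subset)
  have par: "(-1) ^ card T * gcoeff a T = (-1) ^ d * gcoeff a T" for T
  proof (cases "gcoeff a T = 0")
    case False
    then have "card T mod 2 = d" using a by (auto simp: homogeneous_part_def)
    then show ?thesis using minus_one_power_parity[of "card T", where 'k = 'k] by simp
  qed simp
  have RHS: "gcoeff (contraction i a * b + (-1) ^ d * a * contraction i b) S =
      (\<Sum>T\<in>Pow S. \<epsilon> T (S - T) * gcoeff (contraction i a) T * gcoeff b (S - T)) +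
      (\<Sum>T\<in>Pow S. \<epsilon> T (S - T) * ((-1) ^ d * gcoeff a T) * gcoeff (contraction i b) (S - T))"
    by (simp add: plus_grassmann.rep_eq times_grassmann.rep_eq[of _ b]
        times_grassmann.rep_eq[of _ "contraction i b"] gcoeff_signed)
  show "gcoeff (contraction i (a * b)) S
      = gcoeff (contraction i a * b + (-1) ^ d * a * contraction i b) S"
  proof (cases "i \<in> S")
    case False
    define h where "h = (\<lambda>T. \<epsilon> {i} S * (\<epsilon> T (insert i S - T) * gcoeff a T * gcoeff b (insert i S - T)))"
    have "gcoeff (contraction i (a * b)) S = (\<Sum>T\<in>Pow (insert i S). h T)"
      using False by (simp add: contraction.rep_eq times_grassmann.rep_eq h_def sum_distrib_left)
    also have "\<dots> = (\<Sum>T\<in>Pow S. h T) + (\<Sum>T\<in>insert i ` Pow S. h T)"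
      unfolding Pow_insert using S False by (intro sum.union_disjoint) auto
    also have "(\<Sum>T\<in>insert i ` Pow S. h T) = (\<Sum>T\<in>Pow S. h (insert i T))"
      using False by (subst sum.reindex) (auto simp: inj_on_def insert_ident subset_iff)
    also have "\<dots> = (\<Sum>T\<in>Pow S. \<epsilon> T (S - T) * gcoeff (contraction i a) T * gcoeff b (S - T))"
    proof (intro sum.cong refl)
      fix T assume "T \<in> Pow S"
      then have T: "T \<subseteq> S" "finite T" "finite (S - T)" "i \<notin> T" "i \<notin> S - T"
        using fin False by auto
      have 1: "\<epsilon> {i} S = (\<epsilon> {i} T * \<epsilon> {i} (S - T) :: 'k)"
        using gsign_Un_right[of "{i}" T "S - T", where 'k = 'k] T by (auto simp: Un_absorb1)
      have 2: "\<epsilon> (insert i T) (S - T) = (\<epsilon> {i} (S - T) * \<epsilon> T (S - T) :: 'k)"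
        using gsign_Un_left[of "{i}" T "S - T", where 'k = 'k] T by auto
      have 3: "insert i S - insert i T = S - T" using T by auto
      have "h (insert i T) = (\<epsilon> {i} (S - T) * \<epsilon> {i} (S - T)) *
        (\<epsilon> T (S - T) * (\<epsilon> {i} T * gcoeff a (insert i T)) * gcoeff b (S - T))"
        by (simp add: h_def 1 2 3 mult_ac)
      then show "h (insert i T) = \<epsilon> T (S - T) * gcoeff (contraction i a) T * gcoeff b (S - T)"
        using T by (simp add: gsign_square contraction.rep_eq)
    qed
    also have "(\<Sum>T\<in>Pow S. h T) =
      (\<Sum>T\<in>Pow S. \<epsilon> T (S - T) * ((-1) ^ d * gcoeff a T) * gcoeff (contraction i b) (S - T))"
    proof (intro sum.cong refl)
      fix T assume "T \<in> Pow S"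
      then have T: "T \<subseteq> S" "finite T" "finite (S - T)" "i \<notin> T" "i \<notin> S - T"
        using fin False by auto
      have 1: "\<epsilon> {i} S = (\<epsilon> {i} T * \<epsilon> {i} (S - T) :: 'k)"
        using gsign_Un_right[of "{i}" T "S - T", where 'k = 'k] T by (auto simp: Un_absorb1)
      have 2: "\<epsilon> T (insert i (S - T)) = (\<epsilon> T {i} * \<epsilon> T (S - T) :: 'k)"
        using gsign_Un_right[of T "{i}" "S - T", where 'k = 'k] T by auto
      have 3: "insert i S - T = insert i (S - T)" using T by auto
      have "h T = (\<epsilon> T {i} * \<epsilon> {i} T) * gcoeff a T * \<epsilon> T (S - T) *
        (\<epsilon> {i} (S - T) * gcoeff b (insert i (S - T)))"
        by (simp add: h_def 1 2 3 mult_ac)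
      also have "\<dots> = (-1) ^ d * gcoeff a T * \<epsilon> T (S - T) * (\<epsilon> {i} (S - T) * gcoeff b (insert i (S - T)))"
        unfolding gsign_swap[OF T(2,4)] par ..
      finally show "h T = \<epsilon> T (S - T) * ((-1) ^ d * gcoeff a T) * gcoeff (contraction i b) (S - T)"
        using T by (simp add: contraction.rep_eq mult_ac)
    qed
    finally show ?thesis unfolding RHS by simp
  next
    case True
    define S' where "S' = S - {i}"
    have S': "S = insert i S'" "i \<notin> S'" "finite S'" using True S by (auto simp: S'_def)
    have split: "(\<Sum>T\<in>Pow S. g T) = (\<Sum>T\<in>Pow S'. g T) + (\<Sum>T\<in>Pow S'. g (insert i T))"
      for g :: "nat set \<Rightarrow> 'k"
    proof -
      have "(\<Sum>T\<in>Pow S. g T) = (\<Sum>T\<in>Pow S'. g T) + (\<Sum>T\<in>insert i ` Pow S'. g T)"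
        unfolding S'(1) Pow_insert using S' by (intro sum.union_disjoint) auto
      also have "(\<Sum>T\<in>insert i ` Pow S'. g T) = (\<Sum>T\<in>Pow S'. g (insert i T))"
        using S' by (subst sum.reindex) (auto simp: inj_on_def insert_ident subset_iff)
      finally show ?thesis .
    qed
    have "gcoeff (contraction i a * b + (-1) ^ d * a * contraction i b) S =
      (\<Sum>T\<in>Pow S'. \<epsilon> T (S - T) * gcoeff (contraction i a) T * gcoeff b (S - T)
        + \<epsilon> (insert i T) (S - insert i T) * ((-1) ^ d * gcoeff a (insert i T)) *
          gcoeff (contraction i b) (S - insert i T))"
    proof -
      have "(\<Sum>T\<in>Pow S'. \<epsilon> (insert i T) (S - insert i T) * gcoeff (contraction i a) (insert i T) *
          gcoeff b (S - insert i T)) = 0"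
        by (intro sum.neutral) (simp add: contraction.rep_eq)
      moreover have "(\<Sum>T\<in>Pow S'. \<epsilon> T (S - T) * ((-1) ^ d * gcoeff a T) *
          gcoeff (contraction i b) (S - T)) = 0"
        by (intro sum.neutral) (use True S' in \<open>auto simp: contraction.rep_eq\<close>)
      ultimately show ?thesis
        unfolding RHS split sum.distrib by simp
    qed
    also have "\<dots> = 0"
    proof (intro sum.neutral ballI)
      fix T assume "T \<in> Pow S'"
      then have T: "T \<subseteq> S'" "finite T" "finite (S' - T)" "i \<notin> T" "i \<notin> S' - T"
        using finite_subset[OF _ S'(3), of T] S' by auto
      have 1: "S - T = insert i (S' - T)" "S - insert i T = S' - T" using S' T by auto
      have 2: "\<epsilon> T (insert i (S' - T)) = (\<epsilon> T {i} * \<epsilon> T (S' - T) :: 'k)"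
        using gsign_Un_right[of T "{i}" "S' - T", where 'k = 'k] T by auto
      have 3: "\<epsilon> (insert i T) (S' - T) = (\<epsilon> {i} (S' - T) * \<epsilon> T (S' - T) :: 'k)"
        using gsign_Un_left[of "{i}" T "S' - T", where 'k = 'k] T by auto
      have 4: "(-1) ^ d * gcoeff a (insert i T) = - ((\<epsilon> T {i} * \<epsilon> {i} T) * gcoeff a (insert i T))"
        using par[of "insert i T"] T unfolding gsign_swap[OF T(2,4)] by simp
      have "\<epsilon> T (S - T) * gcoeff (contraction i a) T * gcoeff b (S - T) =
        \<epsilon> T {i} * \<epsilon> T (S' - T) * (\<epsilon> {i} T * gcoeff a (insert i T)) * gcoeff b (insert i (S' - T))"
        using T by (simp add: 1 2 contraction.rep_eq)
      moreover have "\<epsilon> (insert i T) (S - insert i T) * ((-1) ^ d * gcoeff a (insert i T)) *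
          gcoeff (contraction i b) (S - insert i T) =
        - ((\<epsilon> {i} (S' - T) * \<epsilon> {i} (S' - T)) *
        (\<epsilon> T {i} * \<epsilon> T (S' - T) * (\<epsilon> {i} T * gcoeff a (insert i T)) * gcoeff b (insert i (S' - T))))"
        unfolding 1 3 4 using T by (simp add: contraction.rep_eq mult_ac)
      ultimately show "\<epsilon> T (S - T) * gcoeff (contraction i a) T * gcoeff b (S - T)
        + \<epsilon> (insert i T) (S - insert i T) * ((-1) ^ d * gcoeff a (insert i T)) *
          gcoeff (contraction i b) (S - insert i T) = 0"
        by (simp add: gsign_square)
    qed
    finally show ?thesis using True by (simp add: contraction.rep_eq)
  qed
qed

lemma End\<Lambda>_I:
  assumes "\<And>a b. f (a + b) = f a + f b" "\<And>c a. f (c *\<^sub>\<Lambda> a) = c *\<^sub>\<Lambda> f a"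
  shows "f \<in> End\<Lambda>"
  using assms by (simp add: Vector_Spaces.linear_iff \<Lambda>.vector_space_axioms)

lemma contraction_odd_superderivation: "odd_superderivation (contraction i)"
proof -
  have "contraction i \<in> End\<Lambda>"
    by (rule End\<Lambda>_I; rule grassmann_eqI; simp add: contraction.rep_eq gcoeff_simps algebra_simps)
  moreover have "contraction i a \<in> homogeneous_part (1 - d)"
    if a: "a \<in> homogeneous_part d" and d: "d \<in> {0, 1}" for a :: "'a grassmann" and d
    unfolding homogeneous_part_def
  proof (intro CollectI allI impI)
    fix S assume "gcoeff (contraction i a) S \<noteq> 0"
    then have S: "i \<notin> S" "gcoeff a (insert i S) \<noteq> 0"
      by (auto simp: contraction.rep_eq split: if_splits)
    then have "finite S" using gcoeff_infinite[of "insert i S" a] by auto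
    moreover have "card (insert i S) mod 2 = d" using S(2) a unfolding homogeneous_part_def by blast
    ultimately have "Suc (card S) mod 2 = d" using S(1) by simp
    then show "card S mod 2 = 1 - d" using d by auto presburger+
  qed
  from this[of _ 0] this[of _ 1] have
    "contraction i ` (homogeneous_part 0 :: 'a grassmann set) \<subseteq> homogeneous_part 1"
    "contraction i ` (homogeneous_part 1 :: 'a grassmann set) \<subseteq> homogeneous_part 0" by auto
  ultimately show ?thesis
    unfolding odd_superderivation_def using contraction_leibniz by blast
qed

lemma contraction_letter: "contraction i (letter j) = (if i = j then 1 else 0)"
  by (rule grassmann_eqI)
     (auto simp: contraction.rep_eq letter_def gmon.rep_eq one_grassmann.rep_eq gcoeff_simps gsign_empty)

theorem ex1_partial:
  "\<exists>!D :: 'k::field grassmann \<Rightarrow> _. odd_superderivation D \<and> (\<forall>j. D (letter j) = (if i = j then 1 else 0))"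
proof (rule ex1I)
  show "odd_superderivation (contraction i :: 'k grassmann \<Rightarrow> _) \<and>
      (\<forall>j. contraction i (letter j) = (if i = j then 1 else 0 :: 'k grassmann))"
    by (simp add: contraction_odd_superderivation contraction_letter)
qed (auto intro!: superderivation_ext simp: contraction_odd_superderivation contraction_letter)

lemma partial_eq_contraction: "\<partial> i = contraction i"
  unfolding partial_def
  by (rule the1_equality[OF ex1_partial]) (simp add: contraction_odd_superderivation contraction_letter)


section \<open>The pivot elements\<close>

text \<open>
  Unfolding \<open>v\<^sub>i = \<partial>\<^sub>i + x\<^sub>i x\<^sub>i\<^sub>+\<^sub>1 v\<^sub>i\<^sub>+\<^sub>2\<close> yields the sum over \<open>k \<ge> 0\<close> of
  \<open>x\<^sub>i x\<^sub>i\<^sub>+\<^sub>1 \<dots> x\<^sub>i\<^sub>+\<^sub>2\<^sub>k\<^sub>-\<^sub>1 \<partial>\<^sub>i\<^sub>+\<^sub>2\<^sub>k\<close>, which has only finitely many nonzero terms on each element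
  (\<open>finite_pivot_support\<close>), so that \<open>Sum_any\<close> is the actual sum.
\<close>

definition pivot :: "nat \<Rightarrow> 'k::field operator" (\<open>\<v>\<close>) where
  "\<v> i a = Sum_any (\<lambda>k. prod_list (map letter [i..<i + 2 * k]) * \<partial> (i + 2 * k) a)"

lemma finite_partial_support: "finite {j. \<partial> j a \<noteq> 0}"
proof (rule finite_subset)
  show "{j. \<partial> j a \<noteq> 0} \<subseteq> \<Union> {S. gcoeff a S \<noteq> 0}"
  proof
    fix j assume "j \<in> {j. \<partial> j a \<noteq> 0}"
    then obtain S where "gcoeff (contraction j a) S \<noteq> 0"
      using grassmann_eqI[of "contraction j a" 0] by (auto simp: partial_eq_contraction gcoeff_simps)
    then have "gcoeff a (insert j S) \<noteq> 0"
      by (auto simp: contraction.rep_eq split: if_splits)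
    then show "j \<in> \<Union> {S. gcoeff a S \<noteq> 0}" by blast
  qed
  show "finite (\<Union> {S. gcoeff a S \<noteq> 0})"
    using finite_gcoeff gcoeff_infinite by blast
qed

lemma finite_pivot_support:
  "finite {k. prod_list (map letter [i..<i + 2 * k]) * \<partial> (i + 2 * k) a \<noteq> 0}"
proof (rule finite_subset)
  show "{k. prod_list (map letter [i..<i + 2 * k]) * \<partial> (i + 2 * k) a \<noteq> 0}
    \<subseteq> (\<lambda>k. i + 2 * k) -` {j. \<partial> j a \<noteq> 0}"
    by auto
  show "finite ((\<lambda>k. i + 2 * k) -` {j. \<partial> j a \<noteq> 0})"
    by (intro finite_vimageI finite_partial_support) (auto intro: injI)
qed

theorem pivot_rec: "\<v> i a = \<partial> i a + letter i * (letter (i + 1) * \<v> (i + 2) a)"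
proof -
  let ?t = "\<lambda>i k. prod_list (map letter [i..<i + 2 * k]) * \<partial> (i + 2 * k) a"
  have step: "?t i (Suc k) = letter i * letter (Suc i) * ?t (i + 2) k" for k
    by (simp add: upt_rec[of i] upt_rec[of "Suc i"] mult.assoc)
  define A where "A = {k. ?t i k \<noteq> 0}"
  define B where "B = {k. ?t (i + 2) k \<noteq> 0}"
  have "finite (A \<union> B)"
    unfolding A_def B_def using finite_pivot_support[of i a] finite_pivot_support[of "i + 2" a] by simp
  then obtain N where "A \<union> B \<subseteq> {..<N}"
    unfolding finite_nat_set_iff_bounded by blast
  then have N: "A \<subseteq> {..<Suc N}" "B \<subseteq> {..<N}"
    by auto
  have "\<v> i a = (\<Sum>k<Suc N. ?t i k)"
    unfolding pivot_def by (rule Sum_any.expand_superset[OF _ N(1)[unfolded A_def]]) simp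
  also have "\<dots> = \<partial> i a + (\<Sum>k<N. ?t i (Suc k))"
    by (subst sum.lessThan_Suc_shift) simp
  also have "(\<Sum>k<N. ?t i (Suc k)) = letter i * letter (Suc i) * (\<Sum>k<N. ?t (i + 2) k)"
    unfolding step sum_distrib_left ..
  also have "(\<Sum>k<N. ?t (i + 2) k) = \<v> (i + 2) a"
    unfolding pivot_def by (rule Sum_any.expand_superset[OF _ N(2)[unfolded B_def], symmetric]) simp
  finally show ?thesis by (simp add: mult.assoc)
qed

lemma partial_End: "\<partial> i \<in> End\<Lambda>"
  using contraction_odd_superderivation unfolding partial_eq_contraction odd_superderivation_def by blast

lemma pivot_End: "\<v> i \<in> End\<Lambda>"
proof (rule End\<Lambda>_I)
  fix a b :: "'a grassmann" and c :: 'a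
  interpret P: Vector_Spaces.linear gscale gscale "\<partial> j :: 'a grassmann \<Rightarrow> _" for j
    using partial_End by simp
  show "\<v> i (a + b) = \<v> i a + \<v> i b"
    unfolding pivot_def P.add distrib_left
    by (rule Sum_any.distrib; rule finite_pivot_support)
  interpret C: Vector_Spaces.linear gscale gscale "gscale c"
    by (simp add: Vector_Spaces.linear_iff \<Lambda>.vector_space_axioms \<Lambda>.scale_right_distrib \<Lambda>.scale_left_commute)
  have "(c *\<^sub>\<Lambda> Sum_any f) = (Sum_any (\<lambda>k. c *\<^sub>\<Lambda> f k) :: 'a grassmann)" if "finite {k. f k \<noteq> 0}"
    for f :: "nat \<Rightarrow> 'a grassmann"
    using that by (subst (1 2) Sum_any.expand_superset[OF that]) (auto simp: C.sum)
  from this[OF finite_pivot_support] show "\<v> i (c *\<^sub>\<Lambda> a) = c *\<^sub>\<Lambda> \<v> i a"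
    unfolding pivot_def P.scale gscale_mult by simp
qed


section \<open>The operator algebra\<close>

definition opscale :: "'k::field \<Rightarrow> 'k operator \<Rightarrow> 'k operator" where
  "opscale c f = (\<lambda>a. c *\<^sub>\<Lambda> f a)"

interpretation Op: vector_space "opscale :: 'k::field \<Rightarrow> 'k operator \<Rightarrow> _"
  by standard (simp_all add: opscale_def fun_eq_iff \<Lambda>.scale_right_distrib \<Lambda>.scale_left_distrib)

definition subalgebra :: "'k::field operator set \<Rightarrow> bool" where
  "subalgebra S \<longleftrightarrow> S \<subseteq> End\<Lambda> \<and> Op.subspace S \<and> (\<forall>f\<in>S. \<forall>g\<in>S. f \<circ> g \<in> S)"

definition Alg :: "'k::field operator set \<Rightarrow> 'k operator set" where
  "Alg G = subalgebra hull G"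

lemma subalgebra_End: "subalgebra End\<Lambda>"
  unfolding subalgebra_def Op.subspace_def
  by (auto simp: Vector_Spaces.linear_iff \<Lambda>.vector_space_axioms opscale_def \<Lambda>.scale_right_distrib \<Lambda>.scale_left_commute algebra_simps)

lemma subalgebra_Alg:
  assumes "G \<subseteq> End\<Lambda>"
  shows "subalgebra (Alg G)" "G \<subseteq> Alg G"
proof -
  have "Alg G \<subseteq> End\<Lambda>"
    unfolding Alg_def using hull_minimal[of G "End\<Lambda>" subalgebra] assms subalgebra_End by blast
  moreover have "Op.subspace (Alg G)"
    unfolding Alg_def hull_def by (rule Op.subspace_Inter) (auto simp: subalgebra_def)
  ultimately show "subalgebra (Alg G)"
    unfolding subalgebra_def by (auto simp: Alg_def hull_def subalgebra_def)
  show "G \<subseteq> Alg G"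
    unfolding Alg_def by (rule hull_subset)
qed

definition pivot_algebra :: "'k::field operator set" (\<open>\<A>\<close>) where
  "\<A> = Alg {\<v> 0, \<v> 1}"

lemma subalgebra_pivot_algebra: "subalgebra \<A>" "\<v> 0 \<in> \<A>" "\<v> 1 \<in> \<A>"
  unfolding pivot_algebra_def using subalgebra_Alg[of "{\<v> 0, \<v> 1}"] pivot_End by auto


section \<open>The monomials\<close>

definition lettermult :: "nat \<Rightarrow> 'k::field operator" (\<open>\<x>\<close>) where
  "\<x> i a = letter i * a"

primrec tail_word :: "nat \<Rightarrow> (nat \<Rightarrow> nat) \<Rightarrow> 'k::field operator" where
  "tail_word 0 \<xi> = id"
| "tail_word (Suc m) \<xi> = tail_word m \<xi> \<circ> (\<x> m ^^ \<xi> m)"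

primrec pivot_word :: "nat \<Rightarrow> (nat \<Rightarrow> nat) \<Rightarrow> 'k::field operator" where
  "pivot_word 0 \<alpha> = id"
| "pivot_word (Suc m) \<alpha> = (\<v> m ^^ \<alpha> m) \<circ> pivot_word m \<alpha>"

text \<open>
  The triple \<open>(n, \<xi>, \<alpha>)\<close> encodes the monomial
  \<open>x\<^sub>0\<^bsup>\<xi> 0\<^esup> \<dots> x\<^sub>n\<^sub>-\<^sub>1\<^bsup>\<xi> (n-1)\<^esup> v\<^sub>n v\<^sub>n\<^sub>-\<^sub>1\<^bsup>\<alpha> (n-1)\<^esup> \<dots> v\<^sub>0\<^bsup>\<alpha> 0\<^esup>\<close>.
\<close>

type_synonym monomial = "nat \<times> (nat \<Rightarrow> nat) \<times> (nat \<Rightarrow> nat)"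

fun monomial_op :: "monomial \<Rightarrow> 'k::field operator" where
  "monomial_op (n, \<xi>, \<alpha>) = tail_word n \<xi> \<circ> \<v> n \<circ> pivot_word n \<alpha>"

text \<open>
  Exponents of letters that do not occur are normalised to \<open>0\<close>, so that every monomial has exactly
  one code.
\<close>

definition exponents :: "nat \<Rightarrow> (nat \<Rightarrow> nat) set" where
  "exponents m = {e. (\<forall>i<m. e i \<in> {0, 1}) \<and> (\<forall>i\<ge>m. e i = 0)}"

definition basis_monomials :: "monomial set" (\<open>\<B>\<close>) where
  "\<B> =
    {(0, \<xi>, \<alpha>) | \<xi> \<alpha>. \<xi> \<in> exponents 0 \<and> \<alpha> \<in> exponents 0} \<union>
    {(1, \<xi>, \<alpha>) | \<xi> \<alpha>. \<xi> \<in> exponents 0 \<and> \<alpha> \<in> exponents 1} \<union>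
    {(2, \<xi>, \<alpha>) | \<xi> \<alpha>. \<xi> \<in> exponents 2 \<and> \<alpha> \<in> exponents 2 \<and> \<xi> 0 + \<xi> 1 \<le> 1} \<union>
    {(n, \<xi>, \<alpha>) | n \<xi> \<alpha>. n \<ge> 3 \<and> \<xi> \<in> exponents n \<and> \<alpha> \<in> exponents n \<and>
      \<xi> (n - 2) + \<xi> (n - 1) \<le> 1 + \<alpha> (n - 1) \<and>
      (n = 3 \<and> \<xi> 0 = 1 \<and> \<xi> 2 = 1 \<longrightarrow> \<xi> 1 = 0 \<and> \<alpha> 2 = 1)}"

text \<open>
  Independence is that of an indexed family: distinct formal monomials must give distinct operators.
\<close>

definition lin_indep_family :: "('i \<Rightarrow> 'k::field operator) \<Rightarrow> 'i set \<Rightarrow> bool" where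
  "lin_indep_family f I \<longleftrightarrow> inj_on f I \<and> Op.independent (f ` I)"

definition basis_family :: "('i \<Rightarrow> 'k::field operator) \<Rightarrow> 'i set \<Rightarrow> 'k operator set \<Rightarrow> bool" where
  "basis_family f I V \<longleftrightarrow> lin_indep_family f I \<and> Op.span (f ` I) = V"

end

theory Submission
  imports Defs
begin

text \<open>
  All computations take place in the ring of endomorphisms, using only the relations
  \<open>v\<^sub>i\<^sup>2 = x\<^sub>i\<^sub>+\<^sub>1 v\<^sub>i\<^sub>+\<^sub>2\<close>, \<open>v\<^sub>i v\<^sub>i\<^sub>+\<^sub>1 + v\<^sub>i\<^sub>+\<^sub>1 v\<^sub>i = - x\<^sub>i v\<^sub>i\<^sub>+\<^sub>2\<close>, \<open>v\<^sub>i x\<^sub>i + x\<^sub>i v\<^sub>i = 1\<close> and the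
  anticommutation of \<open>v\<^sub>j\<close> with \<open>x\<^sub>i\<close> for \<open>i < j\<close>. The span of \<open>\<B>\<close> is closed under right multiplication by
  \<open>v\<^sub>0\<close> and \<open>v\<^sub>1\<close>: the new factor moves to its place in the word, and each collision passes it on to a
  larger index. Conversely every monomial of \<open>\<B>\<close> is obtained from \<open>v\<^sub>0, v\<^sub>1\<close>, first the ones without
  \<open>x\<^sub>n\<^sub>-\<^sub>1\<close> from commutators and then the others, up to sign and monomials already obtained, as
  products such as \<open>x\<^sub>n\<^sub>-\<^sub>2 v\<^sub>n\<^sub>-\<^sub>1 \<cdot> r x\<^sub>n\<^sub>-\<^sub>1 v\<^sub>n\<close>; no division by \<open>2\<close> occurs, so the characteristic plays no
  role. For independence, the component of lowest degree of \<open>x\<^sub>X v\<^sub>n v\<^sub>S\<close> is \<open>x\<^sub>X \<partial>\<^sub>n \<partial>\<^sub>S\<close>, and such products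
  are separated by their values on the monomials \<open>x\<^sub>n x\<^sub>S\<close>.
\<close>

section \<open>The ring of endomorphisms\<close>

text \<open>As a type of their own the endomorphisms form a \<open>ring_1\<close>, so words in
  letters and pivot elements are rewritten by ring simplification.\<close>

typedef (overloaded) 'k endo = "End\<Lambda> :: 'k::field operator set"
  morphisms app Endo
  using partial_End by blast

setup_lifting type_definition_endo

lemma linear_app: "Vector_Spaces.linear gscale gscale (app f)"
  using app[of f] by simp

lemma app_simps:
  "app f (a + b) = app f a + app f b"
  "app f (c *\<^sub>\<Lambda> a) = c *\<^sub>\<Lambda> app f a"
  "app f 0 = 0"
  "app f (- a) = - app f a"
  "app f (a - b) = app f a - app f b"
  "app f (sum g A) = (\<Sum>i\<in>A. app f (g i))"
proof -
  interpret Vector_Spaces.linear gscale gscale "app f"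
    by (rule linear_app)
  show "app f (a + b) = app f a + app f b" "app f (c *\<^sub>\<Lambda> a) = c *\<^sub>\<Lambda> app f a"
    "app f 0 = 0" "app f (- a) = - app f a" "app f (a - b) = app f a - app f b"
    "app f (sum g A) = (\<Sum>i\<in>A. app f (g i))"
    by (rule add scale zero neg diff sum)+
qed

lemma endo_eqI: "(\<And>a. app f a = app g a) \<Longrightarrow> f = g"
  using app_inject by blast

lemma linear_iff_gscale:
  "Vector_Spaces.linear gscale gscale f \<longleftrightarrow>
    (\<forall>a b. f (a + b) = f a + f b) \<and> (\<forall>c a. f (c *\<^sub>\<Lambda> a) = c *\<^sub>\<Lambda> f a)"
  by (simp add: Vector_Spaces.linear_iff \<Lambda>.vector_space_axioms)

instantiation endo :: (field) ring_1
begin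

lift_definition zero_endo :: "'a endo" is "\<lambda>_. 0"
  by (simp add: linear_iff_gscale)

lift_definition one_endo :: "'a endo" is id
  by (simp add: linear_iff_gscale)

lift_definition plus_endo :: "'a endo \<Rightarrow> 'a endo \<Rightarrow> 'a endo" is "\<lambda>f g a. f a + g a"
  by (simp add: linear_iff_gscale \<Lambda>.scale_right_distrib algebra_simps)

lift_definition uminus_endo :: "'a endo \<Rightarrow> 'a endo" is "\<lambda>f a. - f a"
  by (simp add: linear_iff_gscale)

lift_definition minus_endo :: "'a endo \<Rightarrow> 'a endo \<Rightarrow> 'a endo" is "\<lambda>f g a. f a - g a"
  by (simp add: linear_iff_gscale \<Lambda>.scale_right_diff_distrib)

lift_definition times_endo :: "'a endo \<Rightarrow> 'a endo \<Rightarrow> 'a endo" is "(\<circ>)"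
  by (simp add: linear_iff_gscale)

instance
proof
  show "(0 :: 'a endo) \<noteq> 1"
  proof
    assume "(0 :: 'a endo) = 1"
    then have "app (0 :: 'a endo) 1 = app 1 1" by simp
    then show False by (simp add: zero_endo.rep_eq one_endo.rep_eq)
  qed
qed (transfer; auto simp: fun_eq_iff linear_iff_gscale)+

end

lemmas app_ops = zero_endo.rep_eq one_endo.rep_eq plus_endo.rep_eq uminus_endo.rep_eq
  minus_endo.rep_eq times_endo.rep_eq

lift_definition letter_endo :: "nat \<Rightarrow> 'k::field endo" (\<open>\<X>\<close>) is lettermult
  by (simp add: linear_iff_gscale lettermult_def distrib_left gscale_mult)

lift_definition partial_endo :: "nat \<Rightarrow> 'k::field endo" (\<open>\<D>\<close>) is partial
  using partial_End by blast

lift_definition pivot_endo :: "nat \<Rightarrow> 'k::field endo" (\<open>\<V>\<close>) is pivot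
  using pivot_End by blast

section \<open>Relations between letters, derivations and pivot elements\<close>

lemma app_x: "app (\<X> i) a = letter i * a"
  by (simp add: letter_endo.rep_eq lettermult_def)

lemma X_anticommute: "\<X> i * \<X> j = - (\<X> j * \<X> i)"
  by (rule endo_eqI) (simp add: app_ops app_x letter_anticommute[of i j] flip: mult.assoc)

lemma X_square: "\<X> i * \<X> i = 0"
  by (rule endo_eqI) (simp add: app_ops app_x letter_square flip: mult.assoc)

lemma partial_letter_mult: "\<partial> i (letter j * a) = (if i = j then a else 0) - letter j * \<partial> i a"
proof -
  have "(letter j :: 'a grassmann) \<in> homogeneous_part 1"
    by (auto simp: homogeneous_part_def letter_def gmon.rep_eq)
  from contraction_leibniz[OF this, of i a] show ?thesis
    by (simp add: partial_eq_contraction contraction_letter)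
qed

lemma D_X: "\<D> i * \<X> j = (if i = j then 1 else 0) - \<X> j * \<D> i"
  by (rule endo_eqI) (simp add: app_ops app_x partial_endo.rep_eq partial_letter_mult)

text \<open>Every monomial is a product of letters applied to \<open>1\<close>. Squares and
  anticommutators of the derivations commute with all letters, so they can be tested on
  \<open>1\<close>.\<close>

lemma endo_eq_0I:
  assumes "app f 1 = 0" and x: "\<And>j. f * \<X> j = \<X> j * f"
  shows "f = 0"
proof (rule endo_eqI)
  fix a :: "'a grassmann"
  have "app f (letter j * b) = letter j * app f b" for j b
    using arg_cong[OF x[of j], of "\<lambda>g. app g b"] by (simp add: app_ops app_x)
  then have "app f (prod_list (map letter js)) = 0" for js
    by (induction js) (simp_all add: assms(1))
  then have "app f (gmon S) = 0" if "gcoeff a S \<noteq> 0" for S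
    using gcoeff_infinite[of S a] that by (cases "finite S") (auto simp: gmon_eq_prod)
  then show "app f a = app 0 a"
    by (subst grassmann_expand) (simp add: app_simps app_ops)
qed

lemma partial_one: "\<partial> i 1 = 0"
proof -
  have "\<partial> i (letter (Suc i) * 1) = 0 - letter (Suc i) * \<partial> i 1"
    by (subst partial_letter_mult) simp
  moreover have "\<partial> i (letter (Suc i)) = 0"
    by (simp add: partial_eq_contraction contraction_letter)
  ultimately show ?thesis
    by (simp add: partial_eq_contraction)
      (rule grassmann_eqI, simp add: contraction.rep_eq one_grassmann.rep_eq gcoeff_simps)
qed

lemma D_X_left: "\<D> i * (\<X> j * b) = (if i = j then b else 0) - \<X> j * (\<D> i * b)"
  by (simp add: D_X left_diff_distrib flip: mult.assoc)

lemma partial_zero: "\<partial> i 0 = 0"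
  using app_simps(3)[of "\<D> i"] by (simp add: partial_endo.rep_eq)

lemma D_anticommute: "\<D> i * \<D> j = - (\<D> j * \<D> i)"
  unfolding eq_neg_iff_add_eq_0
  by (rule endo_eq_0I)
    (auto simp: app_ops partial_endo.rep_eq partial_one partial_zero algebra_simps D_X D_X_left)

lemma D_square: "\<D> i * \<D> i = 0"
  by (rule endo_eq_0I)
    (auto simp: app_ops partial_endo.rep_eq partial_one partial_zero algebra_simps D_X D_X_left)

section \<open>Pivot elements\<close>

lemma V_rec: "\<V> i = \<D> i + \<X> i * (\<X> (Suc i) * \<V> (Suc (Suc i)))"
  by (rule endo_eqI)
    (simp add: app_ops app_x pivot_endo.rep_eq partial_endo.rep_eq pivot_rec[of i] eval_nat_numeral)

lemma V_eventually_0: "\<exists>N. \<forall>j\<ge>N. app (\<V> j) a = 0"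
proof -
  obtain N where N: "\<And>j. \<partial> j a \<noteq> 0 \<Longrightarrow> j < N"
    using finite_partial_support[of a] unfolding finite_nat_set_iff_bounded by auto
  have "\<v> j a = 0" if "j \<ge> N" for j
  proof -
    have "\<partial> (j + 2 * k) a = 0" for k
      using N[of "j + 2 * k"] that by auto
    then show ?thesis
      by (simp add: pivot_def)
  qed
  then show ?thesis
    by (auto simp: pivot_endo.rep_eq)
qed

text \<open>The recursion raises the index and has no bottom; on a fixed element the tail hypothesis
  provides a start \<open>N\<close>, and the induction descends from there. It serves for
  anticommutators with \<open>\<V> j\<close>.\<close>

lemma endo_tail_eq_0:
  assumes step: "\<And>j. m \<le> j \<Longrightarrow> F j = \<X> j * (\<X> (Suc j) * F (Suc (Suc j)))"
    and tail: "\<And>a. \<exists>N. \<forall>j\<ge>N. app (F j) a = 0"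
    and "m \<le> j"
  shows "F j = 0"
proof (rule endo_eqI)
  fix a
  obtain N where N: "\<And>j. j \<ge> N \<Longrightarrow> app (F j) a = 0"
    using tail by blast
  have "app (F j) a = 0" if "m \<le> j" for j
    using that
  proof (induction "N - j" arbitrary: j rule: less_induct)
    case less
    show ?case
    proof (cases "j \<ge> N")
      case False
      then show ?thesis
        using less.hyps[of "Suc (Suc j)"] less.prems by (simp add: step[of j] app_ops app_x)
    qed (use N in simp)
  qed
  then show "app (F j) a = app 0 a"
    using assms(3) by (simp add: app_ops)
qed

lemma mult_minus_left_assoc: "a * b = - (b * a) \<Longrightarrow> a * (b * c) = - (b * (a * c))" for a b c :: "'a::ring"
  by (metis mult.assoc mult_minus_left)

lemmas X_anticommute_left = mult_minus_left_assoc[OF X_anticommute]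

lemma X_square_left: "\<X> i * (\<X> i * a) = 0"
  by (simp add: X_square flip: mult.assoc)

text \<open>For \<open>i < j\<close>, \<open>\<D> i\<close> anticommutes with \<open>\<D> j\<close>
  and passes the pair \<open>\<X> j\<close>, \<open>\<X> (Suc j)\<close> without a sign, so the
  anticommutator inherits the recursion of \<open>\<V> j\<close>.\<close>

lemma D_V:
  assumes "i < j"
  shows "\<D> i * \<V> j = - (\<V> j * \<D> i)"
  unfolding eq_neg_iff_add_eq_0
proof (rule endo_tail_eq_0[where m = "Suc i" and F = "\<lambda>j. \<D> i * \<V> j + \<V> j * \<D> i"])
  fix j assume "Suc i \<le> j"
  then show "\<D> i * \<V> j + \<V> j * \<D> i =
      \<X> j * (\<X> (Suc j) * (\<D> i * \<V> (Suc (Suc j)) + \<V> (Suc (Suc j)) * \<D> i))"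
    by (subst (1 2) V_rec) (simp add: algebra_simps D_X_left D_anticommute[of i j])
next
  fix a
  obtain N N' where "\<And>j. j \<ge> N \<Longrightarrow> app (\<V> j) a = 0" "\<And>j. j \<ge> N' \<Longrightarrow> app (\<V> j) (app (\<D> i) a) = 0"
    using V_eventually_0 by metis
  then show "\<exists>N. \<forall>j\<ge>N. app (\<D> i * \<V> j + \<V> j * \<D> i) a = 0"
    by (intro exI[of _ "max N N'"]) (simp add: app_ops app_simps)
qed (use assms in simp)

lemma V_X:
  assumes "i < j"
  shows "\<V> j * \<X> i = - (\<X> i * \<V> j)"
  unfolding eq_neg_iff_add_eq_0
proof (rule endo_tail_eq_0[where m = "Suc i" and F = "\<lambda>j. \<V> j * \<X> i + \<X> i * \<V> j"])
  fix j assume "Suc i \<le> j"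
  then show "\<V> j * \<X> i + \<X> i * \<V> j =
      \<X> j * (\<X> (Suc j) * (\<V> (Suc (Suc j)) * \<X> i + \<X> i * \<V> (Suc (Suc j))))"
    by (subst (1 2) V_rec) (simp add: algebra_simps D_X X_anticommute_left[of i])
next
  fix a
  obtain N N' where "\<And>j. j \<ge> N \<Longrightarrow> app (\<V> j) a = 0" "\<And>j. j \<ge> N' \<Longrightarrow> app (\<V> j) (app (\<X> i) a) = 0"
    using V_eventually_0 by metis
  then show "\<exists>N. \<forall>j\<ge>N. app (\<V> j * \<X> i + \<X> i * \<V> j) a = 0"
    by (intro exI[of _ "max N N'"]) (simp add: app_ops app_simps)
qed (use assms in simp)

lemmas V_X_left = mult_minus_left_assoc[OF V_X]

text \<open>The second summand of \<open>V_rec\<close> contains \<open>\<X> i\<close> and dies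
  against another \<open>\<X> i\<close>; what remains is the relation for
  \<open>\<D> i\<close>.\<close>

lemma V_X_self: "\<V> i * \<X> i = 1 - \<X> i * \<V> i"
  by (subst (1 2) V_rec) (simp add: algebra_simps D_X V_X X_square_left X_anticommute_left[of "Suc i" i])

lemma V_X_self_left: "\<V> i * (\<X> i * a) = a - \<X> i * (\<V> i * a)"
  by (simp add: V_X_self left_diff_distrib flip: mult.assoc)

lemma V_square: "\<V> i * \<V> i = \<X> (Suc i) * \<V> (Suc (Suc i))"
proof -
  \<comment> \<open>The first product vanishes by \<open>D_square\<close>, the last by the repeated
    \<open>\<X> i\<close>; the mixed ones cancel up to the term where \<open>\<D> i\<close> hits
    \<open>\<X> i\<close>.\<close>
  have "\<V> i * \<V> i = \<D> i * \<D> i + \<D> i * (\<X> i * (\<X> (Suc i) * \<V> (Suc (Suc i)))) +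
      \<X> i * (\<X> (Suc i) * (\<V> (Suc (Suc i)) * \<D> i)) +
      \<X> i * (\<X> (Suc i) * (\<V> (Suc (Suc i)) * (\<X> i * (\<X> (Suc i) * \<V> (Suc (Suc i))))))"
    by (subst (1 2) V_rec) (simp only: distrib_left distrib_right mult.assoc add_ac)
  also have "\<dots> = \<X> (Suc i) * \<V> (Suc (Suc i))"
    by (simp add: D_square D_X_left D_V V_X_left X_square_left X_anticommute_left[of "Suc i" i])
  finally show ?thesis .
qed

lemma X_V_V_Suc: "\<X> i * (\<V> i * \<V> (Suc i)) = - (\<X> i * (\<V> (Suc i) * \<V> i))"
  by (subst (1 2) V_rec[of i]) (simp add: algebra_simps X_square_left D_V V_X_left)

lemma V_V_Suc: "\<V> i * \<V> (Suc i) = - (\<V> (Suc i) * \<V> i) - \<X> i * \<V> (Suc (Suc i))"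
proof -
  let ?w = "\<X> i * (\<X> (Suc i) * (\<V> (Suc (Suc i)) * \<V> (Suc i)))"
  have *: "\<V> i * \<V> (Suc i) = \<D> i * \<V> (Suc i) + ?w"
    by (subst V_rec[of i]) (simp add: algebra_simps)
  \<comment> \<open>\<open>\<V> (Suc i)\<close> passes \<open>\<X> i\<close> and meets its own
    letter, which yields the summand with \<open>\<X> i\<close>; \<open>?w\<close> appears with the
    sign opposite to that in the previous expansion and cancels.\<close>
  have **: "\<V> (Suc i) * \<V> i = \<V> (Suc i) * \<D> i - \<X> i * \<V> (Suc (Suc i)) - ?w"
    by (subst V_rec[of i])
      (simp add: algebra_simps V_X_left V_X_self_left X_V_V_Suc)
  show ?thesis
    unfolding * ** by (simp add: D_V)
qed

section \<open>Monomials in a ring with the pivot relations\<close>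

text \<open>Reordering words produces signs that need no bookkeeping, since the sets of interest are
  closed under negation.\<close>

definition eq_sign :: "'a::ring_1 \<Rightarrow> 'a \<Rightarrow> bool" (infix \<open>\<doteq>\<close> 50) where
  "a \<doteq> b \<longleftrightarrow> a = b \<or> a = - b"

lemma eq_sign_refl: "a \<doteq> a"
  by (simp add: eq_sign_def)

lemma eq_sign_trans: "a \<doteq> b \<Longrightarrow> b \<doteq> c \<Longrightarrow> a \<doteq> c"
  by (auto simp: eq_sign_def)

lemma eq_sign_sym: "a \<doteq> b \<Longrightarrow> b \<doteq> a"
  by (auto simp: eq_sign_def)

lemma eq_sign_mult: "a \<doteq> b \<Longrightarrow> c \<doteq> e \<Longrightarrow> a * c \<doteq> b * e"
  by (auto simp: eq_sign_def)

lemma eq_sign_commute_mult: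
  assumes "a * c \<doteq> c * a" "b * c \<doteq> c * b"
  shows "(a * b) * c \<doteq> c * (a * b)"
proof -
  have "a * (b * c) \<doteq> a * (c * b)"
    using assms(2) by (auto simp: eq_sign_def)
  also have "a * (c * b) \<doteq> (c * a) * b"
    using assms(1) by (auto simp: eq_sign_def simp flip: mult.assoc)
  finally (eq_sign_trans) show ?thesis
    by (simp add: mult.assoc)
qed

text \<open>The exponent conditions of \<open>\<B>\<close> for the supports \<open>X\<close> of
  \<xi> and \<open>S\<close> of \<alpha>: with exponents at most 1, the inequality for large
  \<open>n\<close> fails only if both letters occur without \<open>v (n - 1)\<close>. Only indices
  below \<open>n\<close> are tested.\<close>

definition admissible :: "nat \<Rightarrow> nat set \<Rightarrow> nat set \<Rightarrow> bool" where
  "admissible n X S \<longleftrightarrow> (n = 1 \<longrightarrow> 0 \<notin> X) \<and> (n = 2 \<longrightarrow> 0 \<notin> X \<or> 1 \<notin> X) \<and>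
    (n \<ge> 3 \<and> n - 2 \<in> X \<and> n - 1 \<in> X \<longrightarrow> n - 1 \<in> S) \<and>
    (n = 3 \<and> 0 \<in> X \<and> 2 \<in> X \<longrightarrow> 1 \<notin> X \<and> 2 \<in> S)"

locale pivot_ring =
  fixes x v :: "nat \<Rightarrow> 'a::ring_1"
  assumes x_square: "x i * x i = 0"
    and x_anticommute: "x i * x j = - (x j * x i)"
    and v_x: "i < j \<Longrightarrow> v j * x i = - (x i * v j)"
    and v_x_self: "v i * x i = 1 - x i * v i"
    and v_square: "v i * v i = x (Suc i) * v (Suc (Suc i))"
    and v_v_Suc: "v i * v (Suc i) = - (v (Suc i) * v i) - x i * v (Suc (Suc i))"
begin

text \<open>Read as a commutator of \<open>v i\<close> with \<open>x i * v (Suc i)\<close>, this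
  recovers \<open>v (Suc i)\<close>. In the span it reorders words; in the algebra it produces pivot
  elements of higher index.\<close>

lemma v_x_v: "v i * (x i * v (Suc i)) = v (Suc i) + x i * (v (Suc i) * v i)"
proof -
  have "x i * (v i * v (Suc i)) = - (x i * (v (Suc i) * v i))"
    by (simp add: v_v_Suc right_diff_distrib x_square flip: mult.assoc[of "x i" "x i"])
  moreover have "v i * (x i * v (Suc i)) = v (Suc i) - x i * (v i * v (Suc i))"
    by (simp add: v_x_self left_diff_distrib flip: mult.assoc)
  ultimately show ?thesis
    by simp
qed

primrec xprod :: "nat \<Rightarrow> nat set \<Rightarrow> 'a" where
  "xprod 0 X = 1"
| "xprod (Suc n) X = xprod n X * (if n \<in> X then x n else 1)"

text \<open>The lower bound \<open>j\<close> marks the place of an inserted factor: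
  \<open>vprod n j S\<close> stands to its left, \<open>vprod j 0 S\<close> to its right.\<close>

primrec vprod :: "nat \<Rightarrow> nat \<Rightarrow> nat set \<Rightarrow> 'a" where
  "vprod 0 j S = 1"
| "vprod (Suc n) j S = (if j \<le> n \<and> n \<in> S then v n else 1) * vprod n j S"

definition pmon :: "nat \<Rightarrow> nat set \<Rightarrow> nat set \<Rightarrow> 'a" where
  "pmon n X S = xprod n X * (v n * vprod n 0 S)"

lemma xprod_cong: "(\<And>i. i < n \<Longrightarrow> i \<in> X \<longleftrightarrow> i \<in> Y) \<Longrightarrow> xprod n X = xprod n Y"
  by (induction n) auto

lemma vprod_cong: "(\<And>i. j \<le> i \<Longrightarrow> i < n \<Longrightarrow> i \<in> S \<longleftrightarrow> i \<in> S') \<Longrightarrow> vprod n j S = vprod n j S'"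
  by (induction n) auto

lemma vprod_trivial: "n \<le> j \<Longrightarrow> vprod n j S = 1"
  by (induction n) auto

lemma vprod_bottom:
  "j < n \<Longrightarrow> vprod n j S = vprod n (Suc j) S * (if j \<in> S then v j else 1)"
proof (induction n)
  case (Suc n)
  then show ?case
    by (cases "j = n") (auto simp: vprod_trivial mult.assoc)
qed simp

lemma vprod_split: "j \<le> n \<Longrightarrow> vprod n 0 S = vprod n j S * vprod j 0 S"
proof (induction n)
  case (Suc n)
  then show ?case
    by (cases "j = Suc n") (auto simp: vprod_trivial mult.assoc)
qed simp

lemma xprod_v: "n \<le> i \<Longrightarrow> xprod n X * v i \<doteq> v i * xprod n X"
proof (induction n)
  case (Suc n)
  have "x n * v i \<doteq> v i * x n"
    using Suc.prems by (simp add: eq_sign_def v_x)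
  with Suc show ?case
    by (auto intro!: eq_sign_commute_mult eq_sign_refl)
qed (simp add: eq_sign_refl)

lemma vprod_x: "i < j \<Longrightarrow> vprod n j S * x i \<doteq> x i * vprod n j S"
proof (induction n)
  case (Suc n)
  have "v n * x i \<doteq> x i * v n" if "j \<le> n"
    using v_x[of i n] Suc.prems that by (auto simp: eq_sign_def)
  with Suc show ?case
    by (auto intro!: eq_sign_commute_mult)
qed (simp add: eq_sign_refl)

lemma xprod_Suc_x:
  fixes X
  defines "y n \<equiv> (if n \<in> X then x n else 1) :: 'a"
  assumes "i < n"
  shows "(xprod (Suc n) X * x i :: 'a) \<doteq> xprod n X * x i * y n"
proof -
  have "y n * x i \<doteq> x i * y n"
    using x_anticommute[of n i] by (auto simp: eq_sign_def y_def)
  then have "xprod n X * (y n * x i) \<doteq> xprod n X * (x i * y n)"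
    by (rule eq_sign_mult[OF eq_sign_refl])
  then show ?thesis
    by (simp add: y_def mult.assoc)
qed

lemma xprod_x: "i < n \<Longrightarrow> i \<notin> X \<Longrightarrow> (xprod n X * x i :: 'a) \<doteq> xprod n (insert i X)"
proof (induction n)
  case (Suc n)
  show ?case
  proof (cases "i = n")
    case False
    then have IH: "(xprod n X * x i :: 'a) \<doteq> xprod n (insert i X)"
      using Suc by simp
    have "xprod n X * x i * (if n \<in> X then x n else 1 :: 'a) \<doteq> xprod (Suc n) (insert i X)"
      using eq_sign_mult[OF IH eq_sign_refl] False by simp
    moreover have "i < n"
      using False Suc.prems by simp
    ultimately show ?thesis
      by (blast intro: eq_sign_trans xprod_Suc_x)
  next
    case True
    then show ?thesis
      using Suc.prems xprod_cong[of n X "insert i X"] by (auto simp: eq_sign_refl)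
  qed
qed simp

lemma xprod_x_same: "i < n \<Longrightarrow> i \<in> X \<Longrightarrow> (xprod n X * x i :: 'a) = 0"
proof (induction n)
  case (Suc n)
  show ?case
  proof (cases "i = n")
    case False
    then have "(xprod n X * x i :: 'a) = 0"
      using Suc by simp
    then show ?thesis
      using xprod_Suc_x[of i n X] Suc.prems False by (simp add: eq_sign_def del: xprod.simps)
  next
    case True
    then show ?thesis
      using Suc.prems by (simp add: mult.assoc x_square)
  qed
qed simp

text \<open>Right multiplication by \<open>y\<close>, after \<open>y\<close> has been moved to the left of the \<open>v\<^sub>i\<close> with \<open>i < j\<close>.\<close>

definition pmon_insert :: "nat \<Rightarrow> nat set \<Rightarrow> nat set \<Rightarrow> nat \<Rightarrow> 'a \<Rightarrow> 'a" where
  "pmon_insert n X S j y = xprod n X * (v n * (vprod n j S * (y * vprod j 0 S)))"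

lemma pmon_mult: "pmon n X S * y = pmon_insert n X S 0 y"
  by (simp add: pmon_def pmon_insert_def mult.assoc)

lemma pmon_insert_top: "pmon_insert n X S n y = xprod n X * (v n * (y * vprod n 0 S))"
  by (simp add: pmon_insert_def vprod_trivial)

lemma xprod_Suc_subset: "X \<subseteq> {..<n} \<Longrightarrow> xprod (Suc n) X = xprod n X"
  by auto

lemma vprod_Suc_subset: "S \<subseteq> {..<n} \<Longrightarrow> vprod (Suc n) j S = vprod n j S"
  by auto

lemma subset_lessThan_Suc: "X \<subseteq> {..<n} \<Longrightarrow> X \<subseteq> {..<Suc n}"
  by auto

lemma xprod_insert: "X \<subseteq> {..<n} \<Longrightarrow> xprod (Suc n) (insert n X) = xprod n X * x n"
  using xprod_cong[of n "insert n X" X] by auto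

lemma vprod_insert: "S \<subseteq> {..<n} \<Longrightarrow> vprod (Suc n) 0 (insert n S) = v n * vprod n 0 S"
  using vprod_cong[of 0 n "insert n S" S] by auto

text \<open>\<open>x i\<close> passes \<open>v n\<close> and all pivot elements of index at least
  \<open>j\<close> up to sign and joins the letters; if it is already there, the square
  vanishes.\<close>

lemma pmon_insert_x:
  assumes "i < j" "i < n"
  shows "pmon_insert n X S j (x i * y) \<doteq> (if i \<in> X then 0 else pmon_insert n (insert i X) S j y)"
proof -
  let ?w = "v n * vprod n j S" and ?z = "y * vprod j 0 S"
  have "v n * x i \<doteq> x i * v n"
    using assms by (simp add: eq_sign_def v_x)
  then have "?w * x i \<doteq> x i * ?w"
    by (intro eq_sign_commute_mult vprod_x assms)
  then have "xprod n X * (?w * x i * ?z) \<doteq> xprod n X * (x i * ?w * ?z)"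
    by (intro eq_sign_mult[OF eq_sign_refl] eq_sign_mult[OF _ eq_sign_refl])
  also have "xprod n X * (x i * ?w * ?z) = (xprod n X * x i) * (?w * ?z)"
    by (simp add: mult.assoc)
  also have "\<dots> \<doteq> (if i \<in> X then 0 else xprod n (insert i X) * (?w * ?z))"
    using eq_sign_mult[OF xprod_x[OF assms(2), of X] eq_sign_refl, of "?w * ?z"] assms(2)
    by (simp add: xprod_x_same eq_sign_refl)
  finally (eq_sign_trans) show ?thesis
    by (cases "i \<in> X") (simp_all add: pmon_insert_def mult.assoc)
qed

lemma pmon_insert_add:
  "pmon_insert n X S j (y + z) = pmon_insert n X S j y + pmon_insert n X S j z"
  "pmon_insert n X S j (- y) = - pmon_insert n X S j y"
  "pmon_insert n X S j (y - z) = pmon_insert n X S j y - pmon_insert n X S j z"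
  by (simp_all add: pmon_insert_def algebra_simps)

text \<open>Moving the cut up by one exposes \<open>v j\<close> as a left factor of the inserted
  element; \<open>pmon_insert_absorb\<close> is the converse move for a \<open>v j\<close> that has
  ended up on the right.\<close>

lemma pmon_insert_bottom:
  assumes "j < n"
  shows "pmon_insert n X S j y =
    pmon_insert n X (S - {j}) (Suc j) ((if j \<in> S then v j else 1) * y)"
  unfolding pmon_insert_def vprod_bottom[OF assms]
  using vprod_cong[of "Suc j" n S "S - {j}"] vprod_cong[of 0 j S "S - {j}"]
  by (simp add: mult.assoc)

lemma pmon_insert_absorb: "pmon_insert n X S (Suc j) (y * v j) = pmon_insert n X (insert j S) (Suc j) y"
  if "j \<notin> S"
  using that vprod_cong[of "Suc j" n S "insert j S"] vprod_cong[of 0 j S "insert j S"]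
  by (simp add: pmon_insert_def mult.assoc)

lemma pmon_insert_one: "j \<le> n \<Longrightarrow> pmon_insert n X S j 1 = pmon n X S"
  by (simp add: pmon_insert_def pmon_def vprod_split[of j n])

end

section \<open>The right ideal of the admissible monomials\<close>

text \<open>\<open>H\<close> stands for the span of \<open>\<B>\<close>; it is an additive subgroup
  because all rewriting has coefficients 1 and -1.\<close>

locale pivot_subgroup = pivot_ring +
  fixes H
  assumes H_zero: "0 \<in> H"
    and H_add: "a \<in> H \<Longrightarrow> b \<in> H \<Longrightarrow> a + b \<in> H"
    and H_uminus: "a \<in> H \<Longrightarrow> - a \<in> H"
    and H_pmon: "admissible n X S \<Longrightarrow> pmon n X S \<in> H"
begin

lemma H_diff: "a \<in> H \<Longrightarrow> b \<in> H \<Longrightarrow> a - b \<in> H"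
  using H_add[OF _ H_uminus] by fastforce

lemma H_eq_sign: "a \<doteq> b \<Longrightarrow> b \<in> H \<Longrightarrow> a \<in> H"
  by (auto simp: eq_sign_def H_uminus)

lemma pmon_insert_x_H:
  assumes "i < j" "i < n" "i \<notin> X \<Longrightarrow> pmon_insert n (insert i X) S j y \<in> H"
  shows "pmon_insert n X S j (x i * y) \<in> H"
  using H_eq_sign[OF pmon_insert_x[OF assms(1,2)]] assms(3) by (auto simp: H_zero)

section \<open>Rewriting steps for an inserted pivot element\<close>

lemma insert_v_top:
  assumes "X \<subseteq> {..<n}" "S \<subseteq> {..<n}" "admissible (Suc (Suc n)) (insert (Suc n) X) S"
  shows "pmon_insert n X S n (v n) \<in> H"
proof -
  have "pmon_insert n X S n (v n) = pmon (Suc (Suc n)) (insert (Suc n) X) S"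
    using assms(1,2)
    by (simp add: pmon_insert_top pmon_def xprod_insert subset_lessThan_Suc xprod_Suc_subset
        vprod_Suc_subset v_square mult.assoc del: xprod.simps vprod.simps flip: mult.assoc[of "v n"])
  then show ?thesis
    using assms(3) by (simp add: H_pmon)
qed

lemma insert_v_notin:
  assumes "j < n" "j \<notin> S" "admissible n X (insert j S)"
  shows "pmon_insert n X S j (v j) \<in> H"
proof -
  have "pmon_insert n X S j (v j) = pmon_insert n X S (Suc j) (1 * v j)"
    using assms(1,2) by (simp add: pmon_insert_bottom)
  also have "\<dots> = pmon n X (insert j S)"
    unfolding pmon_insert_absorb[OF assms(2)] using assms(1) by (simp add: pmon_insert_one)
  finally show ?thesis
    using assms(3) by (simp add: H_pmon)
qed

text \<open>\<open>v m * v m\<close> creates \<open>v (Suc (Suc m))\<close> on the wrong side of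
  \<open>v (Suc m)\<close>; \<open>v_x_v\<close> rearranges this into two words with the new
  top.\<close>

lemma insert_v_below_top:
  assumes "X \<subseteq> {..<Suc m}" "S \<subseteq> {..<Suc m}" "m \<in> S"
    and adm: "admissible (Suc (Suc m)) X (S - {m})"
      "admissible (Suc (Suc m)) (insert (Suc m) X) (insert (Suc m) (S - {m}))"
  shows "pmon_insert (Suc m) X S m (v m) \<in> H"
proof -
  let ?S = "S - {m}"
  have S: "?S \<subseteq> {..<m}"
    using assms(2) by auto
  have "pmon_insert (Suc m) X S m (v m) = pmon_insert (Suc m) X ?S (Suc m) (v m * v m)"
    using assms(3) by (simp add: pmon_insert_bottom)
  also have "\<dots> = xprod (Suc m) X * (v (Suc m) * (x (Suc m) * v (Suc (Suc m))) * vprod (Suc m) 0 ?S)"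
    by (simp add: pmon_insert_top v_square mult.assoc del: xprod.simps vprod.simps)
  also have "\<dots> = pmon (Suc (Suc m)) X ?S
      + pmon (Suc (Suc m)) (insert (Suc m) X) (insert (Suc m) ?S)"
    unfolding v_x_v using assms(1) subset_lessThan_Suc[OF S]
    by (simp add: pmon_def xprod_insert xprod_Suc_subset vprod_insert vprod_Suc_subset
        algebra_simps del: xprod.simps vprod.simps)
  finally show ?thesis
    using adm by (simp add: H_pmon H_add)
qed

text \<open>By \<open>v_square\<close> a letter \<open>x (Suc j)\<close> splits off and joins the
  tail; if it meets \<open>v (Suc j)\<close> on the way, \<open>v_x_v\<close> adds a word without
  that factor. Either way an insertion two places higher remains, which drives the
  inductions.\<close>

lemma insert_v_step:
  assumes "Suc (Suc j) \<le> n" "j \<in> S"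
    and 1: "Suc j \<in> S \<Longrightarrow>
      pmon_insert n X (S - {j} - {Suc j}) (Suc (Suc j)) (v (Suc (Suc j))) \<in> H"
    and 2: "Suc j \<notin> X \<Longrightarrow>
      pmon_insert n (insert (Suc j) X) (S - {j}) (Suc (Suc j)) (v (Suc (Suc j))) \<in> H"
  shows "pmon_insert n X S j (v j) \<in> H"
proof -
  let ?S = "S - {j} - {Suc j}"
  have X: "pmon_insert n X (S - {j}) (Suc (Suc j)) (x (Suc j) * v (Suc (Suc j))) \<in> H"
    by (rule pmon_insert_x_H) (use assms(1) 2 in auto)
  have "pmon_insert n X S j (v j) = pmon_insert n X (S - {j}) (Suc j) (x (Suc j) * v (Suc (Suc j)))"
    using assms(1,2) by (simp add: pmon_insert_bottom[of j] v_square)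
  also have "\<dots> = pmon_insert n X ?S (Suc (Suc j))
      ((if Suc j \<in> S then v (Suc j) else 1) * (x (Suc j) * v (Suc (Suc j))))"
    using assms(1) by (subst pmon_insert_bottom) auto
  finally have *: "pmon_insert n X S j (v j) = \<dots>" .
  show ?thesis
  proof (cases "Suc j \<in> S")
    case True
    then have "insert (Suc j) ?S = S - {j}"
      by auto
    then have "pmon_insert n X ?S (Suc (Suc j)) (x (Suc j) * (v (Suc (Suc j)) * v (Suc j))) =
        pmon_insert n X (S - {j}) (Suc (Suc j)) (x (Suc j) * v (Suc (Suc j)))"
      using pmon_insert_absorb[of "Suc j" ?S n X "x (Suc j) * v (Suc (Suc j))"]
      by (simp add: mult.assoc)
    with True 1 X show ?thesis
      unfolding * by (simp add: v_x_v pmon_insert_add H_add)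
  next
    case False
    then show ?thesis
      unfolding * using X by simp
  qed
qed

lemma insert_v_Suc_top:
  assumes "X \<subseteq> {..<n}" "S \<subseteq> {..<n}"
    and adm: "admissible (Suc n) X (insert n S)" "admissible (Suc (Suc n)) (insert n X) S"
  shows "pmon_insert n X S n (v (Suc n)) \<in> H"
proof -
  have "pmon_insert n X S n (v (Suc n)) = xprod n X * ((v n * v (Suc n)) * vprod n 0 S)"
    by (simp add: pmon_insert_top mult.assoc)
  also have "\<dots> = - pmon (Suc n) X (insert n S) - pmon (Suc (Suc n)) (insert n X) S"
    unfolding v_v_Suc using assms(1,2) xprod_Suc_subset[of "insert n X" "Suc n"]
    by (simp add: pmon_def xprod_insert subset_lessThan_Suc xprod_Suc_subset vprod_insert
        vprod_Suc_subset algebra_simps del: xprod.simps vprod.simps)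
  finally show ?thesis
    using adm by (simp add: H_pmon H_diff H_uminus)
qed

lemma insert_v_Suc_notin:
  assumes "j < n" "j \<notin> S" "pmon_insert n X S (Suc j) (v (Suc j)) \<in> H"
  shows "pmon_insert n X S j (v (Suc j)) \<in> H"
  using assms by (simp add: pmon_insert_bottom[of j])

text \<open>By \<open>v_v_Suc\<close> the factor either passes \<open>v j\<close> or merges with it
  into \<open>x j * v (Suc (Suc j))\<close>, again a factor one above its place, which is now
  \<open>Suc j\<close>.\<close>

lemma insert_v_Suc_step:
  assumes "j < n" "j \<in> S"
    and 1: "pmon_insert n X S (Suc j) (v (Suc j)) \<in> H"
    and 2: "j \<notin> X \<Longrightarrow> pmon_insert n (insert j X) (S - {j}) (Suc j) (v (Suc (Suc j))) \<in> H"
  shows "pmon_insert n X S j (v (Suc j)) \<in> H"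
proof -
  have "insert j (S - {j}) = S"
    using assms(2) by auto
  then have "pmon_insert n X (S - {j}) (Suc j) (v (Suc j) * v j) = pmon_insert n X S (Suc j) (v (Suc j))"
    using pmon_insert_absorb[of j "S - {j}" n X "v (Suc j)"] by simp
  moreover have "pmon_insert n X (S - {j}) (Suc j) (x j * v (Suc (Suc j))) \<in> H"
    by (rule pmon_insert_x_H) (use assms 2 in auto)
  ultimately show ?thesis
    using 1 assms(1,2)
    by (simp add: pmon_insert_bottom[of j] v_v_Suc pmon_insert_add H_diff H_uminus)
qed

text \<open>
  Replacing \<open>v\<^sub>j\<^sup>2\<close> by \<open>x\<^sub>j\<^sub>+\<^sub>1 v\<^sub>j\<^sub>+\<^sub>2\<close> can destroy admissibility only when \<open>j + 2 \<ge> n - 1\<close>, and then inserting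
  \<open>v\<^sub>j\<^sub>+\<^sub>2\<close> yields admissible monomials whatever the tail is.
\<close>

lemma insert_v_large:
  assumes "n \<ge> 4" "j \<le> n" "X \<subseteq> {..<n}" "S \<subseteq> {..<n}" "admissible n X S \<or> n \<le> Suc j"
  shows "pmon_insert n X S j (v j) \<in> H"
  using assms
proof (induction "n - j" arbitrary: j X S rule: less_induct)
  case less
  consider "j = n" | "j < n" "j \<notin> S" | "Suc j = n" "j \<in> S" | "Suc (Suc j) \<le> n" "j \<in> S"
    using less.prems by linarith
  then show ?case
  proof cases
    case 1
    show ?thesis
      unfolding 1 by (rule insert_v_top) (use less.prems in \<open>auto simp: admissible_def\<close>)
  next
    case 2
    then have "n \<le> Suc j \<Longrightarrow> j = n - 1"
      by simp
    with 2 show ?thesis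
      by (intro insert_v_notin) (use less.prems in \<open>auto simp: admissible_def\<close>)
  next
    case 3
    show ?thesis
      unfolding 3(1)[symmetric]
      by (rule insert_v_below_top) (use less.prems 3 in \<open>auto simp: admissible_def\<close>)
  next
    case 4
    then show ?thesis
    proof (rule insert_v_step)
      show "pmon_insert n X (S - {j} - {Suc j}) (Suc (Suc j)) (v (Suc (Suc j))) \<in> H"
        by (rule less.hyps) (use less.prems 4 in \<open>auto simp: admissible_def\<close>)
      show "pmon_insert n (insert (Suc j) X) (S - {j}) (Suc (Suc j)) (v (Suc (Suc j))) \<in> H"
        by (rule less.hyps) (use less.prems 4 in \<open>auto simp: admissible_def\<close>)
    qed
  qed
qed

text \<open>The threshold for \<open>j\<close> is one lower than in \<open>insert_v_large\<close>,
  because a factor that has passed \<open>v j\<close> is handed to that lemma at place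
  \<open>Suc j\<close>.\<close>

lemma insert_v_Suc_large:
  assumes "n \<ge> 4" "j \<le> n" "X \<subseteq> {..<n}" "S \<subseteq> {..<n}" "admissible n X S \<or> n \<le> Suc (Suc j)"
  shows "pmon_insert n X S j (v (Suc j)) \<in> H"
  using assms
proof (induction "n - j" arbitrary: j X S rule: less_induct)
  case less
  consider "j = n" | "j < n" "j \<notin> S" | "j < n" "j \<in> S"
    using less.prems by linarith
  then show ?case
  proof cases
    case 1
    show ?thesis
      unfolding 1 by (rule insert_v_Suc_top) (use less.prems in \<open>auto simp: admissible_def\<close>)
  next
    case 2
    then show ?thesis
      by (rule insert_v_Suc_notin) (rule insert_v_large; use less.prems 2 in auto)
  next
    case 3
    then show ?thesis
    proof (rule insert_v_Suc_step)
      show "pmon_insert n X S (Suc j) (v (Suc j)) \<in> H"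
        by (rule insert_v_large) (use less.prems 3 in auto)
      show "pmon_insert n (insert j X) (S - {j}) (Suc j) (v (Suc (Suc j))) \<in> H"
        by (rule less.hyps) (use less.prems 3 in \<open>auto simp: admissible_def\<close>)
    qed
  qed
qed

section \<open>Monomials with top of index at most 3\<close>

lemma insert_v_3:
  assumes "X \<subseteq> {..<3}" "S \<subseteq> {..<3}"
  shows insert_v_3_3: "pmon_insert 3 X S 3 (v 3) \<in> H"
    and insert_v_3_2: "2 \<in> S \<or> admissible 3 X (insert 2 S) \<Longrightarrow> pmon_insert 3 X S 2 (v 2) \<in> H"
    and "pmon_insert 3 X S 3 (v (Suc 3)) \<in> H"
proof -
  \<comment> \<open>A collision raises the top to 4 or 5, beyond the extra condition on
    \<open>x 0\<close> and \<open>x 2\<close>; only absorbing \<open>v 2\<close> into the word keeps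
    the top at 3.\<close>
  show "pmon_insert 3 X S 3 (v 3) \<in> H"
    by (rule insert_v_top) (use assms in \<open>auto simp: admissible_def\<close>)
  show "pmon_insert 3 X S 3 (v (Suc 3)) \<in> H"
    by (rule insert_v_Suc_top) (use assms in \<open>auto simp: admissible_def\<close>)
  assume *: "2 \<in> S \<or> admissible 3 X (insert 2 S)"
  show "pmon_insert 3 X S 2 (v 2) \<in> H"
  proof (cases "2 \<in> S")
    case True
    then show ?thesis
      using insert_v_below_top[of X 2 S] assms by (fastforce simp: admissible_def)
  next
    case False
    with * show ?thesis
      by (intro insert_v_notin) auto
  qed
qed

lemma insert_v_Suc_3_2:
  assumes "X \<subseteq> {..<3}" "S \<subseteq> {..<3}"
  shows "pmon_insert 3 X S 2 (v 3) \<in> H"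
proof (cases "2 \<in> S")
  case True
  then show ?thesis
    using insert_v_Suc_step[of 2 3 S X] insert_v_3[of X S] insert_v_3[of "insert 2 X" "S - {2}"] assms
    by (auto simp: eval_nat_numeral)
next
  case False
  then show ?thesis
    using insert_v_Suc_notin[of 2 3 S X] insert_v_3[of X S] assms by (auto simp: eval_nat_numeral)
qed

lemma insert_v_Suc_3_1:
  assumes "X \<subseteq> {..<3}" "S \<subseteq> {..<3}" "2 \<in> S \<or> admissible 3 X (insert 2 S)"
  shows "pmon_insert 3 X S 1 (v 2) \<in> H"
proof (cases "1 \<in> S")
  case True
  have "pmon_insert 3 (insert 1 X) (S - {1}) 2 (v 3) \<in> H"
    by (rule insert_v_Suc_3_2) (use assms in auto)
  with True show ?thesis
    using insert_v_Suc_step[of 1 3 S X] insert_v_3_2[of X S] assms by (auto simp: eval_nat_numeral)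
next
  case False
  then show ?thesis
    using insert_v_Suc_notin[of 1 3 S X] insert_v_3_2[of X S] assms by (auto simp: eval_nat_numeral)
qed

lemma pmon_3_times_v:
  assumes "X \<subseteq> {..<3}" "S \<subseteq> {..<3}" "admissible 3 X S"
  shows "pmon 3 X S * v 0 \<in> H" "pmon 3 X S * v 1 \<in> H"
proof -
  show "pmon 3 X S * v 0 \<in> H"
  proof (cases "0 \<in> S")
    case True
    \<comment> \<open>If \<open>x 0\<close> and \<open>x 2\<close> both occur, admissibility puts
      \<open>2\<close> into \<open>S\<close>, so \<open>v 2\<close> collides instead of being
      absorbed, even after \<open>x 1\<close> has joined the tail.\<close>
    have "pmon_insert 3 X (S - {0} - {1}) 2 (v 2) \<in> H" "pmon_insert 3 (insert 1 X) (S - {0}) 2 (v 2) \<in> H"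
      by (rule insert_v_3_2; use assms in \<open>auto simp: admissible_def\<close>)+
    with True show ?thesis
      using insert_v_step[of 0 3 S X] by (auto simp: pmon_mult eval_nat_numeral)
  next
    case False
    then show ?thesis
      using assms unfolding pmon_mult by (intro insert_v_notin) (auto simp: admissible_def)
  qed
  have 1: "pmon_insert 3 X S 1 (v 1) \<in> H"
  proof (cases "1 \<in> S")
    case True
    have "pmon_insert 3 X (S - {1} - {2}) 3 (v 3) \<in> H" "pmon_insert 3 (insert 2 X) (S - {1}) 3 (v 3) \<in> H"
      by (rule insert_v_3_3; use assms in auto)+
    with True show ?thesis
      using insert_v_step[of 1 3 S X] by (auto simp: eval_nat_numeral)
  next
    case False
    then show ?thesis
      using assms by (intro insert_v_notin) (auto simp: admissible_def)
  qed
  show "pmon 3 X S * v 1 \<in> H"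
  proof (cases "0 \<in> S")
    case True
    have "pmon_insert 3 (insert 0 X) (S - {0}) 1 (v 2) \<in> H"
      by (rule insert_v_Suc_3_1) (use assms in \<open>auto simp: admissible_def\<close>)
    with True 1 show ?thesis
      using insert_v_Suc_step[of 0 3 S X] by (auto simp: pmon_mult eval_nat_numeral)
  next
    case False
    with 1 show ?thesis
      using insert_v_Suc_notin[of 0 3 S X] by (auto simp: pmon_mult)
  qed
qed

lemma pmon_2_times_v:
  assumes "X \<subseteq> {..<2}" "S \<subseteq> {..<2}" "admissible 2 X S"
  shows "pmon 2 X S * v 0 \<in> H" "pmon 2 X S * v 1 \<in> H"
proof -
  \<comment> \<open>The resulting words have top 3 or 4 and are admissible even if the tail contains
    both \<open>x 0\<close> and \<open>x 1\<close>.\<close>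
  have 22: "pmon_insert 2 X S 2 (v 2) \<in> H" "pmon_insert 2 X S 2 (v (Suc 2)) \<in> H"
    if "X \<subseteq> {..<2}" "S \<subseteq> {..<2}" for X S
    by (rule insert_v_top insert_v_Suc_top; use that in \<open>auto simp: admissible_def\<close>)+
  show "pmon 2 X S * v 0 \<in> H"
  proof (cases "0 \<in> S")
    case True
    have "pmon_insert 2 X (S - {0} - {1}) 2 (v 2) \<in> H" "pmon_insert 2 (insert 1 X) (S - {0}) 2 (v 2) \<in> H"
      by (rule 22; use assms in auto)+
    with True show ?thesis
      using insert_v_step[of 0 2 S X] by (auto simp: pmon_mult eval_nat_numeral)
  next
    case False
    then show ?thesis
      using assms unfolding pmon_mult by (intro insert_v_notin) (auto simp: admissible_def)
  qed
  have 1: "pmon_insert 2 X S 1 (v 1) \<in> H"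
  proof (cases "1 \<in> S")
    case True
    then show ?thesis
      using insert_v_below_top[of X 1 S] assms by (fastforce simp: admissible_def eval_nat_numeral)
  next
    case False
    then show ?thesis
      using assms by (intro insert_v_notin) (auto simp: admissible_def)
  qed
  show "pmon 2 X S * v 1 \<in> H"
  proof (cases "0 \<in> S")
    case True
    \<comment> \<open>The tail may now be \<open>{0, 1}\<close>, which is not admissible for top 2,
      so the insertion is followed until the top is raised.\<close>
    have "pmon_insert 2 (insert 0 X) (S - {0}) 1 (v 2) \<in> H"
    proof (cases "1 \<in> S")
      case True
      then show ?thesis
        using insert_v_Suc_step[of 1 2 "S - {0}" "insert 0 X"] 22[of "insert 0 X" "S - {0}"]
          22[of "insert 1 (insert 0 X)" "S - {0} - {1}"] assms by (auto simp: eval_nat_numeral)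
    next
      case False
      then show ?thesis
        using insert_v_Suc_notin[of 1 2 "S - {0}" "insert 0 X"] 22[of "insert 0 X" "S - {0}"] assms
        by (auto simp: eval_nat_numeral)
    qed
    with True 1 show ?thesis
      using insert_v_Suc_step[of 0 2 S X] by (auto simp: pmon_mult eval_nat_numeral)
  next
    case False
    with 1 show ?thesis
      using insert_v_Suc_notin[of 0 2 S X] by (auto simp: pmon_mult)
  qed
qed

lemma pmon_1_times_v:
  assumes "S \<subseteq> {..<1}"
  shows "pmon 1 {} S * v 0 \<in> H" "pmon 1 {} S * v 1 \<in> H"
proof -
  show "pmon 1 {} S * v 0 \<in> H"
  proof (cases "0 \<in> S")
    case True
    then show ?thesis
      using insert_v_below_top[of "{}" 0 S] assms by (auto simp: pmon_mult admissible_def)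
  next
    case False
    then show ?thesis
      unfolding pmon_mult by (intro insert_v_notin) (auto simp: admissible_def)
  qed
  have 1: "pmon_insert 1 {} S 1 (v 1) \<in> H"
    by (rule insert_v_top) (use assms in \<open>auto simp: admissible_def\<close>)
  show "pmon 1 {} S * v 1 \<in> H"
  proof (cases "0 \<in> S")
    case True
    have "pmon_insert 1 {0} (S - {0}) 1 (v (Suc 1)) \<in> H"
      by (rule insert_v_Suc_top) (use assms in \<open>auto simp: admissible_def\<close>)
    with True 1 show ?thesis
      using insert_v_Suc_step[of 0 1 S "{}"] by (auto simp: pmon_mult)
  next
    case False
    with 1 show ?thesis
      using insert_v_Suc_notin[of 0 1 S "{}"] by (auto simp: pmon_mult)
  qed
qed

lemma pmon_0_times_v: "pmon 0 {} {} * v 0 \<in> H" "pmon 0 {} {} * v 1 \<in> H"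
  unfolding pmon_mult One_nat_def
  by (rule insert_v_top insert_v_Suc_top; simp add: admissible_def)+

lemma pmon_times_v:
  assumes "admissible n X S"
  shows "pmon n X S * v 0 \<in> H" "pmon n X S * v 1 \<in> H"
proof -
  \<comment> \<open>The insertion lemmas expect subsets of \<open>{..<n}\<close>; entries from
    \<open>n\<close> on do not affect the word.\<close>
  let ?X = "X \<inter> {..<n}" and ?S = "S \<inter> {..<n}"
  have adm: "admissible n ?X ?S"
    using assms by (auto simp: admissible_def)
  have "pmon n ?X ?S * v 0 \<in> H \<and> pmon n ?X ?S * v 1 \<in> H"
  proof (cases "n \<ge> 4")
    case True
    then show ?thesis
      using insert_v_large[of n 0 ?X ?S] insert_v_Suc_large[of n 0 ?X ?S] adm by (simp add: pmon_mult)
  next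
    case False
    then consider "n = 0" | "n = 1" | "n = 2" | "n = 3"
      by linarith
    then show ?thesis
    proof cases
      case 2
      then have "?X = {}"
        using assms by (auto simp: admissible_def)
      then show ?thesis
        using pmon_1_times_v[of ?S] 2 by simp
    qed (use pmon_0_times_v pmon_2_times_v[of ?X ?S] pmon_3_times_v[of ?X ?S] adm in auto)
  qed
  moreover have "pmon n ?X ?S = pmon n X S"
    using xprod_cong[of n X ?X] vprod_cong[of 0 n S ?S] by (simp add: pmon_def)
  ultimately show "pmon n X S * v 0 \<in> H" "pmon n X S * v 1 \<in> H"
    by simp_all
qed

end

section \<open>The admissible monomials lie in the algebra\<close>

locale pivot_subring = pivot_ring +
  fixes A
  assumes A_add: "a \<in> A \<Longrightarrow> b \<in> A \<Longrightarrow> a + b \<in> A"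
    and A_uminus: "a \<in> A \<Longrightarrow> - a \<in> A"
    and A_mult: "a \<in> A \<Longrightarrow> b \<in> A \<Longrightarrow> a * b \<in> A"
    and A_v: "v 0 \<in> A" "v 1 \<in> A"
begin

lemma A_diff: "a \<in> A \<Longrightarrow> b \<in> A \<Longrightarrow> a - b \<in> A"
  using A_add[OF _ A_uminus] by fastforce

text \<open>\<open>x i * v j\<close> is even, so the two signs from each letter of smaller index
  cancel.\<close>

lemma xv_xprod:
  "n \<le> i \<Longrightarrow> n \<le> j \<Longrightarrow> x i * (v j * (xprod n X * c)) = xprod n X * (x i * (v j * c))"
proof (induction n arbitrary: c)
  case (Suc n)
  have "x i * v j * x n = x n * (x i * v j)"
    using Suc.prems by (simp add: mult.assoc v_x x_anticommute[of i n] flip: mult.assoc[of "x i" "x n"])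
  then have "x i * (v j * (x n * c)) = x n * (x i * (v j * c))"
    by (metis mult.assoc)
  with Suc show ?case
    by (simp add: mult.assoc)
qed simp

lemma x_v_in_A: "v n \<in> A \<Longrightarrow> x (Suc n) * v (Suc (Suc n)) \<in> A"
  using A_mult[of "v n" "v n"] by (simp add: v_square)

text \<open>The square of \<open>v n\<close> is \<open>x (Suc n) * v (Suc (Suc n))\<close>, and its
  commutator with \<open>v (Suc n)\<close> is the next pivot element by
  \<open>v_x_v\<close>.\<close>

lemma v_in_A: "v n \<in> A \<and> v (Suc n) \<in> A"
proof (induction n)
  case (Suc n)
  let ?w = "x (Suc n) * v (Suc (Suc n))"
  have "v (Suc (Suc n)) = v (Suc n) * ?w - ?w * v (Suc n)"
    by (simp add: v_x_v mult.assoc)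
  with Suc show ?case
    by (metis A_diff A_mult x_v_in_A)
qed (use A_v in simp)

text \<open>The letters stop at \<open>x n\<close>, two below the top, so these are the tails with
  \<xi> zero just below the top. The induction raises the top by a commutator and gains the letter
  \<open>x (Suc n)\<close> from \<open>v_v_Suc\<close>.\<close>

lemma tail_in_A: "xprod (Suc n) X * v (Suc (Suc n)) \<in> A"
proof (induction n arbitrary: X)
  case 0
  have "x 0 * v (Suc (Suc 0)) = - (v 0 * v (Suc 0) + v (Suc 0) * v 0)"
    by (simp add: v_v_Suc)
  then show ?case
    using v_in_A[of 0] v_in_A[of "Suc 0"] by (simp add: A_mult A_diff A_uminus)
next
  case (Suc n)
  let ?r = "xprod (Suc n) X" and ?w = "x (Suc (Suc n)) * v (Suc (Suc (Suc n)))"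
  let ?e = "?r * v (Suc (Suc n))"
  have e: "?e \<in> A" and w: "?w \<in> A"
    using Suc x_v_in_A v_in_A by auto
  show ?case
  proof (cases "Suc n \<in> X")
    case False
    have "?r * v (Suc (Suc (Suc n))) = ?e * ?w - ?w * ?e"
      by (simp add: mult.assoc v_x_v xv_xprod algebra_simps del: xprod.simps)
    then show ?thesis
      using False e w by (simp add: A_diff A_mult)
  next
    case True
    have "v (Suc n) * ?r \<doteq> ?r * v (Suc n)"
      by (intro eq_sign_sym[OF xprod_v]) simp
    then have "v (Suc n) * ?e \<doteq> ?r * (v (Suc n) * v (Suc (Suc n)))"
      using eq_sign_mult[OF _ eq_sign_refl, of "v (Suc n) * ?r" "?r * v (Suc n)" "v (Suc (Suc n))"]
      by (simp add: mult.assoc del: xprod.simps)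
    moreover have "v (Suc n) * ?e \<in> A"
      using e v_in_A A_mult by blast
    ultimately have "?r * (v (Suc n) * v (Suc (Suc n))) \<in> A"
      using A_uminus by (fastforce simp: eq_sign_def)
    moreover have "?e * v (Suc n) \<in> A"
      using e v_in_A A_mult by blast
    moreover have "?r * x (Suc n) * v (Suc (Suc (Suc n))) =
        - (?r * (v (Suc n) * v (Suc (Suc n)))) - ?e * v (Suc n)"
      by (simp add: v_v_Suc mult.assoc algebra_simps del: xprod.simps)
    ultimately show ?thesis
      using True by (simp add: A_diff A_uminus mult.assoc)
  qed
qed

text \<open>All pivot elements lie in \<open>A\<close>, so only the letters and the top of a
  monomial need work.\<close>

lemma vprod_in_A: "a \<in> A \<Longrightarrow> a * vprod n j S \<in> A"
proof (induction n arbitrary: a)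
  case (Suc n)
  then show ?case
    using A_mult v_in_A by (simp flip: mult.assoc)
qed simp

lemma pmon_in_A:
  assumes "xprod n X * v n \<in> A"
  shows "pmon n X S \<in> A"
  using vprod_in_A[OF assms] by (simp add: pmon_def mult.assoc)

lemma pmon_Suc_in_A:
  assumes "n \<in> S" "xprod (Suc n) X * (v (Suc n) * v n) \<in> A"
  shows "pmon (Suc n) X S \<in> A"
  using vprod_in_A[OF assms(2)] assms(1) by (simp add: pmon_def mult.assoc)

text \<open>The letter directly below the top comes from the square of \<open>?v\<close>, whose two
  factors are distributed over two elements of \<open>A\<close>; whether \<open>x (Suc k)\<close>
  occurs decides which of the two products is used.\<close>

lemma head_in_A:
  "xprod (Suc (Suc k)) X * (x (Suc (Suc (Suc k))) * v (Suc (Suc (Suc (Suc k))))) \<in> A"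
proof -
  let ?q = "xprod (Suc k) X" and ?v = "v (Suc (Suc k))"
  have "(?q * ?v) * ?v \<in> A" "(x (Suc k) * ?v) * (?q * ?v) \<in> A"
    using tail_in_A[of k X] v_in_A[of k] v_in_A[of "Suc (Suc k)"] x_v_in_A[of k]
    by (simp_all add: A_mult del: xprod.simps)
  moreover have "(x (Suc k) * ?v) * (?q * ?v) = ?q * (x (Suc k) * (?v * ?v))"
    using xv_xprod[of "Suc k" "Suc k" "Suc (Suc k)"] by (simp add: mult.assoc del: xprod.simps)
  ultimately show ?thesis
    by (simp add: v_square mult.assoc split: if_splits)
qed

text \<open>\<open>v_x_v\<close> splits the product of \<open>x m * v (Suc m)\<close> with the first
  element into the third element and the wanted one. The surviving \<open>v (Suc m)\<close> matches
  the condition \<open>n - 1 \<in> S\<close> in \<open>admissible\<close>.\<close>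

lemma x_x_v_v_in_A:
  assumes "xprod m X * (x (Suc m) * v (Suc (Suc m))) \<in> A" "x m * v (Suc m) \<in> A"
    "xprod m X * (x m * v (Suc (Suc m))) \<in> A"
  shows "xprod m X * (x m * (x (Suc m) * (v (Suc (Suc m)) * v (Suc m)))) \<in> A"
proof -
  have "(x m * v (Suc m)) * (xprod m X * (x (Suc m) * v (Suc (Suc m)))) =
      xprod m X * (x m * (v (Suc m) * (x (Suc m) * v (Suc (Suc m)))))"
    by (simp add: mult.assoc xv_xprod)
  also have "\<dots> = xprod m X * (x m * v (Suc (Suc m))) +
      xprod m X * (x m * (x (Suc m) * (v (Suc (Suc m)) * v (Suc m))))"
    by (simp add: v_x_v distrib_left)
  finally show ?thesis
    using A_diff[OF A_mult[OF assms(2,1)] assms(3)] by simp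
qed

lemma admissible_large_in_A:
  assumes "admissible (Suc (Suc (Suc (Suc k)))) X S"
  shows "pmon (Suc (Suc (Suc (Suc k)))) X S \<in> A"
proof -
  let ?m = "Suc (Suc k)"
  consider "Suc ?m \<notin> X" | "Suc ?m \<in> X" "?m \<notin> X" | "Suc ?m \<in> X" "?m \<in> X" "Suc ?m \<in> S"
    using assms by (auto simp: admissible_def)
  then show ?thesis
  proof cases
    case 1
    then show ?thesis
      using tail_in_A[of ?m X] by (intro pmon_in_A) simp
  next
    case 2
    then show ?thesis
      using head_in_A[of k X] by (intro pmon_in_A) (simp add: mult.assoc)
  next
    case 3
    have "xprod ?m X * (x ?m * (x (Suc ?m) * (v (Suc (Suc ?m)) * v (Suc ?m)))) \<in> A"
      using head_in_A[of k X] x_v_in_A[of "Suc k"] v_in_A[of k] tail_in_A[of ?m X] 3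
      by (intro x_x_v_v_in_A) (simp_all add: mult.assoc)
    with 3 show ?thesis
      by (intro pmon_Suc_in_A) (simp_all add: mult.assoc)
  qed
qed

lemma x_v_v_in_A:
  assumes "i < m" "x i * v (Suc m) \<in> A" "x m * v (Suc m) \<in> A" "x i * v m \<in> A"
  shows "x i * (x m * (v (Suc m) * v m)) \<in> A"
proof -
  have "(x i * v m) * (x m * v (Suc m)) = x i * v (Suc m) + x i * (x m * (v (Suc m) * v m))"
    by (simp add: mult.assoc v_x_v distrib_left)
  then show ?thesis
    using A_diff[OF A_mult[OF assms(4,3)] assms(2)] by simp
qed

text \<open>\<open>head_in_A\<close> starts at top 4. At top 3 the letter \<open>x 2\<close> comes
  from the square of \<open>v 1\<close>, and a further \<open>x 0\<close> or \<open>x 1\<close> is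
  reached only in the company of \<open>v 2\<close>.\<close>

lemma admissible_3_in_A:
  assumes "admissible 3 X S"
  shows "pmon 3 X S \<in> A"
proof -
  have x2: "x 2 * v 3 \<in> A" and x1: "x 1 * v 2 \<in> A" and x0: "x 0 * v 2 \<in> A"
    using x_v_in_A[of 1] x_v_in_A[of 0] v_in_A[of 0] tail_in_A[of 0 "{0}"]
    by (simp_all add: eval_nat_numeral)
  have x0': "x 0 * v 3 \<in> A" and x1': "x 1 * v 3 \<in> A"
    using tail_in_A[of 1 "{0}"] tail_in_A[of 1 "{1}"] by (simp_all add: eval_nat_numeral)
  have xprod: "xprod 3 X = (if 0 \<in> X then x 0 else 1) * (if 1 \<in> X then x 1 else 1) *
      (if 2 \<in> X then x 2 else 1)"
    by (simp add: eval_nat_numeral)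
  have *: "pmon 3 X S \<in> A" if "2 \<in> S" "xprod 3 X = x i * x 2" "i < 2" for i
  proof -
    have "x i * (x 2 * (v 3 * v 2)) \<in> A"
      using x_v_v_in_A[of i 2] x2 x1 x0 x0' x1' that(3) by (auto simp: less_2_cases_iff)
    then show ?thesis
      using pmon_Suc_in_A[of 2 S X] that by (simp add: mult.assoc del: xprod.simps)
  qed
  consider "2 \<notin> X" | "2 \<in> X" "0 \<notin> X" "1 \<notin> X" | "2 \<in> X" "0 \<in> X" "1 \<notin> X" "2 \<in> S"
    | "2 \<in> X" "0 \<notin> X" "1 \<in> X" "2 \<in> S"
    using assms unfolding admissible_def by auto
  then show ?thesis
  proof cases
    case 1
    then show ?thesis
      using tail_in_A[of 1 X] by (intro pmon_in_A) (simp add: eval_nat_numeral)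
  next
    case 2
    then show ?thesis
      using x2 by (intro pmon_in_A) (simp add: xprod)
  next
    case 3
    then show ?thesis
      by (intro *[of 0]) (simp_all add: xprod)
  next
    case 4
    then show ?thesis
      by (intro *[of 1]) (simp_all add: xprod)
  qed
qed

lemma admissible_in_A:
  assumes "admissible n X S"
  shows "pmon n X S \<in> A"
proof -
  consider "n = 0" | "n = 1" | "n = 2" | "n = 3" | k where "n = Suc (Suc (Suc (Suc k)))"
    by (metis One_nat_def Suc_1 numeral_3_eq_3 old.nat.exhaust)
  then show ?thesis
  proof cases
    case 3
    have "pmon 2 X S \<in> A"
      using tail_in_A[of 0 X] x_v_in_A[of 0] v_in_A[of 0] assms 3
      by (intro pmon_in_A) (auto simp: admissible_def eval_nat_numeral split: if_splits)
    with 3 show ?thesis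
      by simp
  qed (use assms v_in_A[of 0] admissible_3_in_A admissible_large_in_A in
      \<open>auto intro!: pmon_in_A simp: admissible_def\<close>)
qed

end

section \<open>Leading terms\<close>

text \<open>The filtration of endomorphisms by lowest degree; \<open>e\<close> is an integer because
  derivations lower the degree.\<close>

definition raises :: "int \<Rightarrow> 'k::field endo set" where
  "raises e = {f. \<forall>a k. (\<forall>S. gcoeff a S \<noteq> 0 \<longrightarrow> k \<le> int (card S)) \<longrightarrow>
    (\<forall>T. gcoeff (app f a) T \<noteq> 0 \<longrightarrow> k + e \<le> int (card T))}"

lemma raisesI:
  assumes "\<And>a k T. (\<And>S. gcoeff a S \<noteq> 0 \<Longrightarrow> k \<le> int (card S)) \<Longrightarrow> gcoeff (app f a) T \<noteq> 0 \<Longrightarrow>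
    k + e \<le> int (card T)"
  shows "f \<in> raises e"
  using assms unfolding raises_def by blast

lemma raisesD:
  assumes "f \<in> raises e" "\<And>S. gcoeff a S \<noteq> 0 \<Longrightarrow> k \<le> int (card S)" "gcoeff (app f a) T \<noteq> 0"
  shows "k + e \<le> int (card T)"
  using assms unfolding raises_def by blast

lemma raises_antimono: "f \<in> raises e \<Longrightarrow> e' \<le> e \<Longrightarrow> f \<in> raises e'"
proof (rule raisesI)
  fix a k T
  assume f: "f \<in> raises e" and "e' \<le> e" and a: "\<And>S. gcoeff a S \<noteq> 0 \<Longrightarrow> k \<le> int (card S)"
    and T: "gcoeff (app f a) T \<noteq> 0"
  with raisesD[OF f a T] show "k + e' \<le> int (card T)"
    by simp
qed

lemma raises_add: "f \<in> raises e \<Longrightarrow> g \<in> raises e \<Longrightarrow> f + g \<in> raises e"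
proof (rule raisesI)
  fix a k T
  assume f: "f \<in> raises e" and g: "g \<in> raises e" and a: "\<And>S. gcoeff a S \<noteq> 0 \<Longrightarrow> k \<le> int (card S)"
    and T: "gcoeff (app (f + g) a) T \<noteq> 0"
  from T have "gcoeff (app f a) T \<noteq> 0 \<or> gcoeff (app g a) T \<noteq> 0"
    by (auto simp: app_ops gcoeff_simps)
  then show "k + e \<le> int (card T)"
    using raisesD[OF f a] raisesD[OF g a] by blast
qed

lemma raises_mult: "f \<in> raises e \<Longrightarrow> g \<in> raises e' \<Longrightarrow> f * g \<in> raises (e + e')"
proof (rule raisesI)
  fix a k T
  assume f: "f \<in> raises e" and g: "g \<in> raises e'" and a: "\<And>S. gcoeff a S \<noteq> 0 \<Longrightarrow> k \<le> int (card S)"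
    and T: "gcoeff (app (f * g) a) T \<noteq> 0"
  have "k + e' \<le> int (card S)" if "gcoeff (app g a) S \<noteq> 0" for S
    using g a that by (rule raisesD)
  from raisesD[OF f this] T show "k + (e + e') \<le> int (card T)"
    by (force simp: app_ops)
qed

lemma raises_one: "1 \<in> raises 0"
  by (rule raisesI) (simp add: app_ops)

lemma gcoeff_letter_mult:
  assumes "gcoeff (letter i * a) T \<noteq> 0"
  shows "i \<in> T" "gcoeff a (T - {i}) \<noteq> 0"
proof -
  have "\<exists>U\<in>Pow T. \<epsilon> U (T - U) * gcoeff (letter i) U * gcoeff a (T - U) \<noteq> 0"
    using assms unfolding times_grassmann.rep_eq by (metis (no_types, lifting) sum.neutral)
  then obtain U where "U \<subseteq> T" "gcoeff (letter i :: 'a grassmann) U \<noteq> 0" "gcoeff a (T - U) \<noteq> 0"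
    by auto
  moreover from this have "U = {i}"
    by (auto simp: letter_def gmon.rep_eq split: if_splits)
  ultimately show "i \<in> T" "gcoeff a (T - {i}) \<noteq> 0"
    by auto
qed

lemma raises_X: "\<X> i \<in> raises 1"
proof (rule raisesI)
  fix a :: "'a grassmann" and k T
  assume a: "\<And>S. gcoeff a S \<noteq> 0 \<Longrightarrow> k \<le> int (card S)" and T: "gcoeff (app (\<X> i) a) T \<noteq> 0"
  have "finite T"
    using gcoeff_infinite T by blast
  moreover have "i \<in> T" "gcoeff a (T - {i}) \<noteq> 0"
    using gcoeff_letter_mult[of i a T] T by (simp_all add: app_x)
  ultimately show "k + 1 \<le> int (card T)"
    using card.remove[of T i] a[of "T - {i}"] by simp
qed

lemma raises_D: "\<D> i \<in> raises (- 1)"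
proof (rule raisesI)
  fix a :: "'a grassmann" and k T
  assume a: "\<And>S. gcoeff a S \<noteq> 0 \<Longrightarrow> k \<le> int (card S)" and T: "gcoeff (app (\<D> i) a) T \<noteq> 0"
  then have T: "i \<notin> T" "gcoeff a (insert i T) \<noteq> 0"
    by (auto simp: partial_endo.rep_eq partial_eq_contraction contraction.rep_eq split: if_splits)
  then have "finite T"
    using gcoeff_infinite by (metis finite_insert)
  with a[OF T(2)] T(1) show "k + - 1 \<le> int (card T)"
    by simp
qed

text \<open>The index climbs in \<open>V_rec\<close>, so the induction descends from an
  \<open>N\<close> beyond which the pivot elements kill \<open>a\<close>; the two letters in front
  only raise the degree.\<close>

lemma raises_V: "\<V> i \<in> raises (- 1)"
proof (rule raisesI)
  fix a :: "'a grassmann" and k T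
  assume a: "\<And>S. gcoeff a S \<noteq> 0 \<Longrightarrow> k \<le> int (card S)" and "gcoeff (app (\<V> i) a) T \<noteq> 0"
  obtain N where N: "\<And>j. j \<ge> N \<Longrightarrow> app (\<V> j) a = 0"
    using V_eventually_0 by blast
  show "k + - 1 \<le> int (card T)"
    using \<open>gcoeff (app (\<V> i) a) T \<noteq> 0\<close>
  proof (induction "N - i" arbitrary: i T rule: less_induct)
    case less
    have "i < N"
      using less.prems N[of i] by (cases "i < N") (auto simp: gcoeff_simps)
    have "gcoeff (app (\<D> i) a) T \<noteq> 0 \<or>
        gcoeff (app (\<X> i * \<X> (Suc i)) (app (\<V> (Suc (Suc i))) a)) T \<noteq> 0"
      using less.prems by (subst (asm) V_rec) (auto simp: app_ops gcoeff_simps)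
    then show ?case
    proof
      assume "gcoeff (app (\<D> i) a) T \<noteq> 0"
      with raises_D a show ?thesis
        by (rule raisesD)
    next
      assume T: "gcoeff (app (\<X> i * \<X> (Suc i)) (app (\<V> (Suc (Suc i))) a)) T \<noteq> 0"
      have "k + - 1 \<le> int (card S)" if "gcoeff (app (\<V> (Suc (Suc i))) a) S \<noteq> 0" for S
        using less.hyps[of "Suc (Suc i)" S] that \<open>i < N\<close> by auto
      from raisesD[OF raises_mult[OF raises_X raises_X] this T] show ?thesis
        by simp
    qed
  qed
qed

text \<open>\<open>g\<close> plays the role of the component of lowest degree of
  \<open>f\<close>.\<close>

definition leads :: "int \<Rightarrow> 'k::field endo \<Rightarrow> 'k endo \<Rightarrow> bool" where
  "leads e f g \<longleftrightarrow> f \<in> raises e \<and> f - g \<in> raises (e + 1)"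

lemma leads_self: "f \<in> raises e \<Longrightarrow> leads e f f"
  by (simp add: leads_def) (rule raisesI, simp add: app_ops gcoeff_simps)

lemma leads_mult:
  assumes "leads e f g" "leads e' f' g'" "g \<in> raises e"
  shows "leads (e + e') (f * f') (g * g')"
proof -
  have "(f - g) * f' \<in> raises (e + 1 + e')" "g * (f' - g') \<in> raises (e + (e' + 1))"
    using assms by (auto intro!: raises_mult simp: leads_def)
  then have "(f - g) * f' + g * (f' - g') \<in> raises (e + e' + 1)"
    by (intro raises_add) (simp_all add: algebra_simps)
  moreover have "(f - g) * f' + g * (f' - g') = f * f' - g * g'"
    by (simp add: algebra_simps)
  ultimately show ?thesis
    using assms by (simp add: leads_def raises_mult)
qed

lemma leads_V: "leads (- 1) (\<V> i) (\<D> i)"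
proof -
  have "\<X> i * (\<X> (Suc i) * \<V> (Suc (Suc i))) \<in> raises (1 + (1 + - 1))"
    by (intro raises_mult raises_X raises_V)
  then have "\<V> i - \<D> i \<in> raises 0"
    by (subst V_rec) (auto intro: raises_antimono)
  then show ?thesis
    by (simp add: leads_def raises_V)
qed

interpretation endo: pivot_ring "\<X> :: nat \<Rightarrow> 'k::field endo" \<V>
  by standard (rule X_square X_anticommute V_X V_X_self V_square V_V_Suc; assumption?)+

primrec dprod :: "nat \<Rightarrow> nat set \<Rightarrow> 'k::field endo" where
  "dprod 0 S = 1"
| "dprod (Suc n) S = (if n \<in> S then \<D> n else 1) * dprod n S"

text \<open>The degree of the leading term: each letter adds one, each derivation subtracts one, and
  the final one belongs to the top \<open>n\<close>.\<close>

definition excess :: "nat \<Rightarrow> nat set \<Rightarrow> nat set \<Rightarrow> int" where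
  "excess n X S = int (card (X \<inter> {..<n})) - int (card (S \<inter> {..<n})) - 1"

lemma card_Int_lessThan_Suc:
  "card (S \<inter> {..<Suc n}) = (if n \<in> S then Suc (card (S \<inter> {..<n})) else card (S \<inter> {..<n}))"
  by (simp add: lessThan_Suc)

lemma raises_xprod: "endo.xprod n X \<in> raises (int (card (X \<inter> {..<n})))"
proof (induction n)
  case (Suc n)
  show ?case
    using raises_mult[OF Suc raises_X, of n] Suc by (simp add: card_Int_lessThan_Suc add.commute)
qed (simp add: raises_one)

lemma leads_vprod: "leads (- int (card (S \<inter> {..<n}))) (endo.vprod n 0 S) (dprod n S)"
proof (induction n)
  case (Suc n)
  show ?case
    using leads_mult[OF leads_V Suc raises_D, of n] Suc by (simp add: card_Int_lessThan_Suc add.commute)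
qed (simp add: raises_one leads_self)

lemma leads_pmon: "leads (excess n X S) (endo.pmon n X S) (endo.xprod n X * (\<D> n * dprod n S))"
  using leads_mult[OF leads_self[OF raises_xprod[of n X]]
      leads_mult[OF leads_V[of n] leads_vprod[of S n] raises_D] raises_xprod]
  by (simp add: endo.pmon_def excess_def algebra_simps)

section \<open>Action of leading terms on monomials\<close>

lemma gsign_nonzero: "\<epsilon> S T \<noteq> (0 :: 'k::field)"
  using gsign_square[of S T, where 'k = 'k] by auto

lemma D_gmon:
  assumes "finite U"
  shows "app (\<D> i) (gmon U) = (if i \<in> U then \<epsilon> {i} (U - {i}) *\<^sub>\<Lambda> gmon (U - {i}) else 0)"
  by (rule grassmann_eqI)
    (use assms in \<open>auto simp: partial_endo.rep_eq partial_eq_contraction contraction.rep_eq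
      gcoeff_simps gmon.rep_eq insert_absorb\<close>)

lemma X_gmon:
  assumes "finite U"
  shows "app (\<X> i) (gmon U) = (if i \<in> U then 0 else \<epsilon> {i} U *\<^sub>\<Lambda> gmon (insert i U))"
  using assms by (simp add: app_x letter_def gmon_times)

lemma dprod_gmon:
  assumes "finite U"
  shows "\<exists>c. c \<noteq> 0 \<and> app (dprod n S) (gmon U :: 'k::field grassmann) =
    (if S \<inter> {..<n} \<subseteq> U then c *\<^sub>\<Lambda> gmon (U - S \<inter> {..<n}) else 0)"
proof (induction n)
  case 0
  then show ?case
    by (auto simp: app_ops intro: exI[of _ 1])
next
  case (Suc n)
  then obtain c :: 'k where c: "c \<noteq> 0" "app (dprod n S) (gmon U) =
      (if S \<inter> {..<n} \<subseteq> U then c *\<^sub>\<Lambda> gmon (U - S \<inter> {..<n}) else 0)"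
    by blast
  show ?case
  proof (cases "n \<in> S")
    case True
    let ?U = "U - S \<inter> {..<n}"
    have "?U - {n} = U - S \<inter> {..<Suc n}"
      using True by (auto simp: lessThan_Suc)
    then show ?thesis
      using True c assms gsign_nonzero[of "{n}" "?U - {n}"]
      by (intro exI[of _ "c * \<epsilon> {n} (?U - {n})"])
        (auto simp: app_ops app_simps D_gmon lessThan_Suc)
  next
    case False
    then have "S \<inter> {..<Suc n} = S \<inter> {..<n}"
      by (auto simp: less_Suc_eq)
    then show ?thesis
      using False c by (auto simp: app_ops)
  qed
qed

lemma xprod_gmon:
  assumes "finite U"
  shows "\<exists>c. c \<noteq> 0 \<and> app (endo.xprod n X) (gmon U :: 'k::field grassmann) =
    (if X \<inter> {..<n} \<inter> U = {} then c *\<^sub>\<Lambda> gmon (U \<union> X \<inter> {..<n}) else 0)"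
  using assms
proof (induction n arbitrary: U)
  case 0
  then show ?case
    by (auto simp: app_ops intro: exI[of _ 1])
next
  case (Suc n)
  show ?case
  proof (cases "n \<in> X")
    case True
    \<comment> \<open>\<open>\<X> n\<close> is the rightmost factor and acts first, hence the
      induction hypothesis at \<open>insert n U\<close>.\<close>
    obtain c :: 'k where c: "c \<noteq> 0" "app (endo.xprod n X) (gmon (insert n U)) =
        (if X \<inter> {..<n} \<inter> insert n U = {} then c *\<^sub>\<Lambda> gmon (insert n U \<union> X \<inter> {..<n}) else 0)"
      using Suc.IH[of "insert n U"] Suc.prems by auto
    moreover have "insert n U \<union> X \<inter> {..<n} = U \<union> X \<inter> {..<Suc n}"
      using True by (auto simp: lessThan_Suc)
    ultimately show ?thesis
      using True Suc.prems gsign_nonzero[of "{n}" U]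
      by (intro exI[of _ "c * \<epsilon> {n} U"])
        (auto simp: app_ops app_simps X_gmon lessThan_Suc mult.commute)
  next
    case False
    then have "X \<inter> {..<Suc n} = X \<inter> {..<n}"
      by (auto simp: less_Suc_eq)
    then show ?thesis
      using False Suc.IH[OF Suc.prems] by (auto simp: app_ops)
  qed
qed

text \<open>This lets the top count as one more element of the set of derivations.\<close>

lemma dprod_insert: "dprod (Suc n) (insert n S) = (\<D> n * dprod n S :: 'k::field endo)"
proof -
  have "dprod m (insert n S) = (dprod m S :: 'k endo)" if "m \<le> n" for m
    using that by (induction m) auto
  then show ?thesis
    by simp
qed

lemma lead_gmon:
  assumes "finite U" "S \<subseteq> {..<n}" "X \<subseteq> {..<n}"
  shows "\<exists>c. c \<noteq> 0 \<and> app (endo.xprod n X * (\<D> n * dprod n S)) (gmon U :: 'k::field grassmann) =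
    (if insert n S \<subseteq> U \<and> X \<inter> (U - insert n S) = {} then c *\<^sub>\<Lambda> gmon (U - insert n S \<union> X) else 0)"
proof -
  have S: "insert n S \<inter> {..<Suc n} = insert n S" and X: "X \<inter> {..<n} = X"
    using assms by auto
  obtain b :: 'k where b: "b \<noteq> 0" "app (dprod (Suc n) (insert n S)) (gmon U) =
      (if insert n S \<subseteq> U then b *\<^sub>\<Lambda> gmon (U - insert n S) else 0)"
    using dprod_gmon[OF assms(1), of "Suc n" "insert n S"] unfolding S by blast
  obtain c :: 'k where "c \<noteq> 0" "app (endo.xprod n X) (gmon (U - insert n S)) =
      (if X \<inter> (U - insert n S) = {} then c *\<^sub>\<Lambda> gmon (U - insert n S \<union> X) else 0)"
    using xprod_gmon[of "U - insert n S" n X] assms(1) unfolding X by blast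
  with b show ?thesis
    by (intro exI[of _ "b * c"]) (auto simp: app_ops app_simps simp flip: dprod_insert simp del: dprod.simps)
qed

section \<open>Linear independence\<close>

lemma sum_operator_apply: "(\<Sum>i\<in>F. f i) a = (\<Sum>i\<in>F. f i a :: 'k::field grassmann)"
  by (induction F rule: infinite_finite_induct) auto

lemma gcoeff_sum: "gcoeff (\<Sum>i\<in>F. f i) T = (\<Sum>i\<in>F. gcoeff (f i) T)"
  by (induction F rule: infinite_finite_induct) (auto simp: gcoeff_simps)

lemma lin_indep_familyI:
  fixes f :: "'i \<Rightarrow> 'k::field operator"
  assumes "\<And>F c i. finite F \<Longrightarrow> F \<subseteq> I \<Longrightarrow> (\<Sum>i\<in>F. opscale (c i) (f i)) = 0 \<Longrightarrow> i \<in> F \<Longrightarrow> c i = 0"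
  shows "lin_indep_family f I"
  unfolding lin_indep_family_def
proof
  show inj: "inj_on f I"
  proof (rule inj_onI, rule ccontr)
    fix i j assume ij: "i \<in> I" "j \<in> I" "f i = f j" "i \<noteq> j"
    \<comment> \<open>Equal values at \<open>i\<close> and \<open>j\<close> give a relation with
      coefficients 1 and -1, the first of which is nonzero over every field.\<close>
    define c :: "'i \<Rightarrow> 'k" where "c k = (if k = i then 1 else - 1)" for k
    have "(\<Sum>k\<in>{i, j}. opscale (c k) (f k)) = 0"
      using ij by (auto simp: c_def opscale_def fun_eq_iff)
    from assms[OF _ _ this, of i] ij show False
      by (simp add: c_def)
  qed
  show "Op.independent (f ` I)"
    unfolding Op.independent_explicit_module
  proof (intro allI impI)
    fix t :: "'k operator set" and u g
    assume t: "finite t" "t \<subseteq> f ` I" "(\<Sum>h\<in>t. opscale (u h) h) = 0" "g \<in> t"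
    then obtain F where F: "finite F" "F \<subseteq> I" "t = f ` F"
      by (meson finite_subset_image)
    then have "(\<Sum>i\<in>F. opscale (u (f i)) (f i)) = 0"
      using t(3) sum.reindex[OF inj_on_subset[OF inj F(2)], of "\<lambda>h. opscale (u h) h"] by simp
    with assms[OF F(1,2), of "\<lambda>i. u (f i)"] show "u g = 0"
      using t(4) F(3) by blast
  qed
qed

text \<open>Triangularity: a larger excess puts all values in degree above that of \<open>X\<close>.
  At equal excess only the leading term contributes; it requires \<open>insert n' S'\<close> inside
  \<open>insert n S\<close>, and the cardinality condition forces equality, with the top as the
  maximum of the set.\<close>

lemma pmon_coefficient:
  assumes S: "S \<subseteq> {..<n}" and X: "X \<subseteq> {..<n}" and S': "S' \<subseteq> {..<n'}" and X': "X' \<subseteq> {..<n'}"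
    and excess: "excess n X S \<le> excess n' X' S'"
    and card: "excess n X S = excess n' X' S' \<Longrightarrow> card S \<le> card S'"
  shows "gcoeff (app (endo.pmon n' X' S') (gmon (insert n S) :: 'k::field grassmann)) X \<noteq> 0 \<longleftrightarrow>
    n' = n \<and> X' = X \<and> S' = S"
proof -
  let ?e = "excess n' X' S'" and ?U = "insert n S"
  let ?m = "endo.pmon n' X' S' :: 'k endo" and ?l = "endo.xprod n' X' * (\<D> n' * dprod n' S') :: 'k endo"
  have fin: "finite X" "finite S" "finite X'" "finite S'"
    using assms by (auto intro: finite_subset)
  have card_U: "card ?U = Suc (card S)" and card_U': "card (insert n' S') = Suc (card S')"
    using S S' fin by (auto intro!: card_insert_disjoint)
  have excess_eq: "excess n X S = int (card X) - int (card ?U)"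
    using S X by (simp add: excess_def Int_absorb2 card_U)
  have gmon: "int (card ?U) \<le> int (card T)" if "gcoeff (gmon ?U :: 'k grassmann) T \<noteq> 0" for T
    using that by (simp add: gmon.rep_eq split: if_splits)
  have raises: "gcoeff (app f (gmon ?U)) X = 0" if "f \<in> raises e" "e > excess n X S" for f :: "'k endo" and e
    using raisesD[OF that(1) gmon] that(2) excess_eq by fastforce
  show ?thesis
  proof (cases "?e = excess n X S")
    case False
    then have "gcoeff (app ?m (gmon ?U)) X = 0"
      using leads_pmon[of n' X' S', where 'a = 'k] excess by (intro raises) (auto simp: leads_def)
    with False show ?thesis
      by auto
  next
    case True
    have "gcoeff (app (?m - ?l) (gmon ?U)) X = 0"
      using leads_pmon[of n' X' S', where 'a = 'k] True by (intro raises) (auto simp: leads_def)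
    then have "gcoeff (app ?m (gmon ?U)) X = gcoeff (app ?l (gmon ?U)) X"
      by (simp add: app_ops gcoeff_simps)
    moreover obtain c :: 'k where "c \<noteq> 0" "app ?l (gmon ?U) =
        (if insert n' S' \<subseteq> ?U \<and> X' \<inter> (?U - insert n' S') = {}
         then c *\<^sub>\<Lambda> gmon (?U - insert n' S' \<union> X') else 0)"
      using lead_gmon[of ?U S' n' X'] fin S' X' by auto
    ultimately have *: "gcoeff (app ?m (gmon ?U)) X \<noteq> 0 \<longleftrightarrow>
        insert n' S' \<subseteq> ?U \<and> X' \<inter> (?U - insert n' S') = {} \<and> X = ?U - insert n' S' \<union> X'"
      using fin by (auto simp: gcoeff_simps gmon.rep_eq)
    have "n' = n \<and> S' = S" if "insert n' S' \<subseteq> ?U"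
    proof -
      have eq: "insert n' S' = ?U"
        using that card[OF True[symmetric]] card_U card_U' fin by (intro card_seteq) simp_all
      then have "n' = n"
        using S S' by (metis insert_iff lessThan_iff less_asym subsetD)
      with eq S S' show ?thesis
        by (metis insert_ident lessThan_iff less_irrefl subsetD)
    qed
    then show ?thesis
      unfolding * by auto
  qed
qed

lemma pmon_independent:
  fixes c :: "nat \<times> nat set \<times> nat set \<Rightarrow> 'k::field"
  assumes F: "finite F" "\<And>n X S. (n, X, S) \<in> F \<Longrightarrow> X \<subseteq> {..<n} \<and> S \<subseteq> {..<n}"
    and sum: "(\<Sum>(n, X, S)\<in>F. opscale (c (n, X, S)) (app (endo.pmon n X S))) = 0"
    and "m \<in> F"
  shows "c m = 0"
proof (rule ccontr)
  assume "c m \<noteq> 0"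
  define F' where "F' = {m \<in> F. c m \<noteq> 0}"
  define ex where "ex = (\<lambda>(n, X, S). excess n X S)"
  define size where "size = (\<lambda>(n :: nat, X :: nat set, S :: nat set). card S)"
  have "m \<in> F'"
    using \<open>c m \<noteq> 0\<close> \<open>m \<in> F\<close> by (simp add: F'_def)
  then have F': "finite F'" "F' \<noteq> {}"
    using F(1) by (auto simp only: F'_def finite_Collect_conjI Collect_mem_eq)
  \<comment> \<open>Among the terms with nonzero coefficient, first the excess and then the
    cardinality of \<open>S\<close> is minimised, as \<open>pmon_coefficient\<close> asks of the
    term that supplies the test monomial.\<close>
  define F'' where "F'' = {m \<in> F'. ex m = Min (ex ` F')}"
  have "Min (ex ` F') \<in> ex ` F'"
    using F' by simp
  then obtain m1 where "m1 \<in> F'" "ex m1 = Min (ex ` F')"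
    by (metis imageE)
  then have "m1 \<in> F''"
    by (simp add: F''_def)
  then have F'': "finite F''" "F'' \<noteq> {}"
    using F'(1) by (auto simp only: F''_def finite_Collect_conjI Collect_mem_eq)
  have "Min (size ` F'') \<in> size ` F''"
    using F'' by simp
  then obtain n X S where m0: "(n, X, S) \<in> F''" "size (n, X, S) = Min (size ` F'')"
    by (metis (no_types, lifting) imageE prod_cases3)
  have "(n, X, S) \<in> F" "c (n, X, S) \<noteq> 0"
    using m0(1) by (simp_all add: F''_def F'_def)
  with F(2) have nXS: "X \<subseteq> {..<n}" "S \<subseteq> {..<n}" "(n, X, S) \<in> F" "c (n, X, S) \<noteq> 0"
    by blast+
  let ?g = "\<lambda>(n', X', S'). gcoeff (app (endo.pmon n' X' S') (gmon (insert n S) :: 'k grassmann)) X"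
  have "?g m' \<noteq> 0 \<longleftrightarrow> m' = (n, X, S)" if m': "m' \<in> F'" for m'
  proof -
    obtain n' X' S' where [simp]: "m' = (n', X', S')"
      by (cases m') auto
    have "ex (n, X, S) = Min (ex ` F')"
      using m0(1) by (simp add: F''_def)
    moreover have le: "Min (ex ` F') \<le> ex m'"
      using F' m' by simp
    moreover have "size (n, X, S) \<le> size m'" if "ex m' = Min (ex ` F')"
      using m0(2) F'' m' that by (simp add: F''_def)
    moreover have "X' \<subseteq> {..<n'}" "S' \<subseteq> {..<n'}"
      using F(2)[of n' X' S'] m' by (simp_all add: F'_def)
    ultimately show ?thesis
      using pmon_coefficient[of S n X S' n' X', where 'k = 'k] nXS by (auto simp: ex_def size_def)
  qed
  then have "(\<Sum>m'\<in>F. c m' * ?g m') = (\<Sum>m'\<in>F. if m' = (n, X, S) then c m' * ?g m' else 0)"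
    by (intro sum.cong) (auto simp: F'_def)
  also have "\<dots> = c (n, X, S) * ?g (n, X, S)"
    using F(1) nXS by simp
  also have "\<dots> \<noteq> 0"
    using nXS pmon_coefficient[of S n X S n X, where 'k = 'k] by simp
  finally have "(\<Sum>m'\<in>F. c m' * ?g m') \<noteq> 0" .
  moreover have "(\<Sum>m'\<in>F. c m' * ?g m') =
      gcoeff ((\<Sum>(n, X, S)\<in>F. opscale (c (n, X, S)) (app (endo.pmon n X S))) (gmon (insert n S))) X"
    by (simp add: sum_operator_apply gcoeff_sum split_def opscale_def gcoeff_simps)
  ultimately show False
    unfolding sum by (simp add: gcoeff_simps)
qed

section \<open>Codes of monomials\<close>

text \<open>Normalised monomials, admissible or not; independence is shown for this larger
  family.\<close>

definition codes :: "monomial set" where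
  "codes = {(n, \<xi>, \<alpha>). \<xi> \<in> exponents n \<and> \<alpha> \<in> exponents n}"

definition support :: "(nat \<Rightarrow> nat) \<Rightarrow> nat set" where
  "support e = {i. e i \<noteq> 0}"

lemma mem_support: "i \<in> support e \<longleftrightarrow> e i \<noteq> 0"
  by (simp add: support_def)

lemma exponents_le_1: "e \<in> exponents n \<Longrightarrow> e i \<le> 1"
  by (cases "i < n") (auto simp: exponents_def)

lemma exponents_eq_1_iff: "e \<in> exponents n \<Longrightarrow> e i = 1 \<longleftrightarrow> i \<in> support e"
  using exponents_le_1[of e n i] by (auto simp: mem_support)

lemma support_exponents: "e \<in> exponents n \<Longrightarrow> support e \<subseteq> {..<n}"
  by (rule subsetI, rule ccontr) (simp add: exponents_def mem_support)

lemma support_inject: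
  assumes "e \<in> exponents n" "e' \<in> exponents n" "support e = support e'"
  shows "e = e'"
proof
  fix i
  show "e i = e' i"
    using exponents_le_1[OF assms(1), of i] exponents_le_1[OF assms(2), of i] assms(3)
      mem_support[of i e] mem_support[of i e'] by auto
qed

lemma tail_word_eq:
  "(\<And>i. i < n \<Longrightarrow> \<xi> i \<in> {0, 1}) \<Longrightarrow> tail_word n \<xi> = app (endo.xprod n (support \<xi>))"
proof (induction n)
  case (Suc n)
  then have "\<xi> n = 0 \<or> \<xi> n = 1"
    by simp
  then show ?case
    by (rule disjE) (use Suc in \<open>simp_all add: app_ops letter_endo.rep_eq mem_support\<close>)
qed (simp add: app_ops)

lemma pivot_word_eq:
  "(\<And>i. i < n \<Longrightarrow> \<alpha> i \<in> {0, 1}) \<Longrightarrow> pivot_word n \<alpha> = app (endo.vprod n 0 (support \<alpha>))"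
proof (induction n)
  case (Suc n)
  then have "\<alpha> n = 0 \<or> \<alpha> n = 1"
    by simp
  then show ?case
    by (rule disjE) (use Suc in \<open>simp_all add: app_ops pivot_endo.rep_eq mem_support\<close>)
qed (simp add: app_ops)

lemma monomial_op_eq:
  assumes "(n, \<xi>, \<alpha>) \<in> codes"
  shows "monomial_op (n, \<xi>, \<alpha>) = app (endo.pmon n (support \<xi>) (support \<alpha>))"
  using assms
  by (simp add: codes_def exponents_def tail_word_eq pivot_word_eq endo.pmon_def app_ops pivot_endo.rep_eq comp_assoc)

text \<open>For top 1, \<open>\<B>\<close> takes \<xi> from \<open>exponents 0\<close> but
  \<open>codes\<close> takes it from \<open>exponents 1\<close>; the gap is the condition
  \<open>0 \<notin> X\<close> in \<open>admissible\<close>.\<close>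

lemma exponents_0_iff: "e \<in> exponents 0 \<longleftrightarrow> e \<in> exponents 1 \<and> 0 \<notin> support e"
  by (auto simp: exponents_def mem_support Suc_le_eq) (metis gr0I)

lemma basis_monomials_iff:
  "(n, \<xi>, \<alpha>) \<in> \<B> \<longleftrightarrow> (n, \<xi>, \<alpha>) \<in> codes \<and> admissible n (support \<xi>) (support \<alpha>)"
proof -
  consider "n = 0" | "n = 1" | "n = 2" | "n \<ge> 3"
    by linarith
  then show ?thesis
  proof cases
    case 1
    then show ?thesis
      by (simp add: basis_monomials_def codes_def admissible_def)
  next
    case 2
    then show ?thesis
      by (auto simp: basis_monomials_def codes_def admissible_def exponents_0_iff)
  next
    case 3
    have "\<xi> 0 + \<xi> 1 \<le> 1 \<longleftrightarrow> 0 \<notin> support \<xi> \<or> 1 \<notin> support \<xi>" if "\<xi> \<in> exponents 2"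
      using exponents_le_1[OF that, of 0] exponents_le_1[OF that, of 1] unfolding mem_support by linarith
    with 3 show ?thesis
      by (auto simp: basis_monomials_def codes_def admissible_def)
  next
    case 4
    have "\<xi> (n - 2) + \<xi> (n - 1) \<le> 1 + \<alpha> (n - 1) \<longleftrightarrow>
        (n - 2 \<in> support \<xi> \<and> n - 1 \<in> support \<xi> \<longrightarrow> n - 1 \<in> support \<alpha>)"
      if "\<xi> \<in> exponents n" "\<alpha> \<in> exponents n"
      using exponents_le_1[OF that(1), of "n - 2"] exponents_le_1[OF that(1), of "n - 1"]
        exponents_le_1[OF that(2), of "n - 1"] unfolding mem_support by linarith
    moreover have "(n = 3 \<and> \<xi> 0 = 1 \<and> \<xi> 2 = 1 \<longrightarrow> \<xi> 1 = 0 \<and> \<alpha> 2 = 1) \<longleftrightarrow>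
        (n = 3 \<and> 0 \<in> support \<xi> \<and> 2 \<in> support \<xi> \<longrightarrow> 1 \<notin> support \<xi> \<and> 2 \<in> support \<alpha>)"
      if "\<xi> \<in> exponents n" "\<alpha> \<in> exponents n"
      unfolding exponents_eq_1_iff[OF that(1)] exponents_eq_1_iff[OF that(2)] by (simp add: mem_support)
    ultimately show ?thesis
      using 4 unfolding basis_monomials_def codes_def admissible_def by simp blast
  qed
qed

lemma ex_basis_monomial:
  assumes "admissible n X S"
  shows "\<exists>\<xi> \<alpha>. (n, \<xi>, \<alpha>) \<in> \<B> \<and>
    monomial_op (n, \<xi>, \<alpha>) = (app (endo.pmon n X S) :: 'k::field operator)"
proof -
  \<comment> \<open>Cutting at \<open>n\<close> normalises the exponents and leaves the operator
    unchanged, since words read only indices below \<open>n\<close>.\<close>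
  define \<xi> \<alpha> :: "nat \<Rightarrow> nat" where "\<xi> i = of_bool (i \<in> X \<and> i < n)" and "\<alpha> i = of_bool (i \<in> S \<and> i < n)" for i
  have supp: "support \<xi> = X \<inter> {..<n}" "support \<alpha> = S \<inter> {..<n}"
    by (auto simp: \<xi>_def \<alpha>_def mem_support)
  have codes: "(n, \<xi>, \<alpha>) \<in> codes"
    by (auto simp: codes_def exponents_def \<xi>_def \<alpha>_def)
  moreover have "admissible n (X \<inter> {..<n}) (S \<inter> {..<n})"
    using assms by (auto simp: admissible_def)
  moreover have op: "monomial_op (n, \<xi>, \<alpha>) = (app (endo.pmon n X S) :: 'k operator)"
    unfolding monomial_op_eq[OF codes] endo.pmon_def supp
    using endo.xprod_cong[of n "X \<inter> {..<n}" X, where 'k = 'k]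
      endo.vprod_cong[of 0 n "S \<inter> {..<n}" S, where 'k = 'k] by simp
  ultimately show ?thesis
    by (intro exI[of _ \<xi>] exI[of _ \<alpha>]) (simp add: basis_monomials_iff supp del: monomial_op.simps)
qed

lemma lin_indep_monomials:
  assumes "I \<subseteq> codes"
  shows "lin_indep_family (monomial_op :: monomial \<Rightarrow> 'k::field operator) I"
proof (rule lin_indep_familyI)
  fix F and c :: "monomial \<Rightarrow> 'k" and m
  assume F: "finite F" "F \<subseteq> I" "(\<Sum>m\<in>F. opscale (c m) (monomial_op m)) = 0" "m \<in> F"
  let ?h = "\<lambda>(n, \<xi>, \<alpha>). (n, support \<xi>, support \<alpha>)"
  have F_codes: "(n, \<xi>, \<alpha>) \<in> codes" if "(n, \<xi>, \<alpha>) \<in> F" for n \<xi> \<alpha>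
    using that F(2) assms by blast
  have inj: "inj_on ?h F"
  proof (rule inj_onI)
    fix m1 m2 assume *: "m1 \<in> F" "m2 \<in> F" "?h m1 = ?h m2"
    obtain n \<xi> \<alpha> n' \<xi>' \<alpha>' where m: "m1 = (n, \<xi>, \<alpha>)" "m2 = (n', \<xi>', \<alpha>')"
      by (metis prod_cases3)
    with * have "\<xi> = \<xi>'" "\<alpha> = \<alpha>'"
      using F_codes[of n \<xi> \<alpha>] F_codes[of n' \<xi>' \<alpha>']
      by (auto simp: codes_def intro: support_inject)
    with * m show "m1 = m2"
      by simp
  qed
  \<comment> \<open>The coefficients are carried to triples of sets along the injective map
    \<open>?h\<close>.\<close>
  define c' where "c' = c \<circ> the_inv_into F ?h"
  have c': "c' (?h m) = c m" if "m \<in> F" for m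
    using the_inv_into_f_f[OF inj that] by (simp add: c'_def)
  have "(\<Sum>(n, X, S)\<in>?h ` F. opscale (c' (n, X, S)) (app (endo.pmon n X S))) =
      (\<Sum>m\<in>F. opscale (c m) (monomial_op m))"
    unfolding sum.reindex[OF inj]
  proof (intro sum.cong refl)
    fix m assume "m \<in> F"
    then show "((\<lambda>(n, X, S). opscale (c' (n, X, S)) (app (endo.pmon n X S))) \<circ> ?h) m =
        opscale (c m) (monomial_op m)"
      using c'[of m] F_codes by (cases m) (simp add: monomial_op_eq del: monomial_op.simps)
  qed
  moreover have "X \<subseteq> {..<n} \<and> S \<subseteq> {..<n}" if nXS: "(n, X, S) \<in> ?h ` F" for n X S
  proof -
    obtain \<xi> \<alpha> where "(n, \<xi>, \<alpha>) \<in> F" "X = support \<xi>" "S = support \<alpha>"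
      using nXS by auto
    then show ?thesis
      using F_codes[of n \<xi> \<alpha>] support_exponents[of _ n] by (simp add: codes_def)
  qed
  ultimately have "c' (?h m) = 0"
    using F by (intro pmon_independent[of "?h ` F" c']) auto
  with c'[OF F(4)] show "c m = 0"
    by simp
qed

section \<open>The pivot algebra\<close>

lemma app_plus: "app (f + g) = app f + app g"
  by (simp add: fun_eq_iff app_ops)

lemma app_uminus: "app (- f) = opscale (- 1) (app f)"
  by (simp add: fun_eq_iff app_ops opscale_def)

lemma app_zero: "app 0 = 0"
  by (simp add: fun_eq_iff app_ops)

lemma End\<Lambda>_comp:
  assumes "w \<in> End\<Lambda>"
  shows "w \<circ> (f + g) = (w \<circ> f) + (w \<circ> g)" "w \<circ> opscale c f = opscale c (w \<circ> f)" "w \<circ> 0 = 0"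
proof -
  interpret Vector_Spaces.linear gscale gscale w
    using assms by simp
  show "w \<circ> (f + g) = (w \<circ> f) + (w \<circ> g)" "w \<circ> opscale c f = opscale c (w \<circ> f)" "w \<circ> 0 = 0"
    by (auto simp: fun_eq_iff opscale_def add scale)
qed

lemma comp_fun:
  "(f + g) \<circ> h = (f \<circ> h) + (g \<circ> h)" "opscale c f \<circ> h = opscale c (f \<circ> h)" "0 \<circ> h = 0"
  by (auto simp: fun_eq_iff opscale_def)

lemma monomial_op_End: "m \<in> \<B> \<Longrightarrow> monomial_op m \<in> End\<Lambda>"
  using app by (cases m) (simp add: basis_monomials_iff monomial_op_eq del: monomial_op.simps)

lemma pivot_subgroup_span:
  "pivot_subgroup (\<X> :: nat \<Rightarrow> 'k::field endo) \<V> {f. app f \<in> Op.span (monomial_op ` \<B>)}"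
proof
  show "endo.pmon n X S \<in> {f :: 'k endo. app f \<in> Op.span (monomial_op ` \<B>)}" if "admissible n X S" for n X S
    using ex_basis_monomial[OF that, where 'k = 'k] by (metis Op.span_base imageI mem_Collect_eq)
qed (auto simp: app_plus app_uminus app_zero Op.span_zero Op.span_add intro: Op.span_neg)

theorem pivot_algebra_subset_span: "(\<A> :: 'k::field operator set) \<subseteq> Op.span (monomial_op ` \<B>)"
proof -
  let ?W = "Op.span (monomial_op ` \<B>) :: 'k operator set"
  interpret pivot_subgroup "\<X> :: nat \<Rightarrow> 'k endo" \<V> "{f. app f \<in> ?W}"
    by (rule pivot_subgroup_span)
  have End: "?W \<subseteq> End\<Lambda>"
    using subalgebra_End monomial_op_End by (intro Op.span_minimal) (auto simp: subalgebra_def simp del: monomial_op.simps)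
  have right: "w \<circ> \<v> i \<in> ?W" if "w \<in> ?W" "i = 0 \<or> i = 1" for w i
    using that(1)
  proof (induction rule: Op.span_induct)
    show "Op.subspace {w. w \<circ> \<v> i \<in> ?W}"
      unfolding Op.subspace_def
      by (simp add: comp_fun Op.span_zero Op.span_add Op.span_scale)
    fix w :: "'k operator" assume "w \<in> monomial_op ` \<B>"
    then obtain n \<xi> \<alpha> where m: "(n, \<xi>, \<alpha>) \<in> \<B>" "w = monomial_op (n, \<xi>, \<alpha>)"
      by (metis imageE prod_cases3)
    then have "admissible n (support \<xi>) (support \<alpha>)" "w = app (endo.pmon n (support \<xi>) (support \<alpha>))"
      by (simp_all add: basis_monomials_iff monomial_op_eq del: monomial_op.simps)
    with pmon_times_v[of n "support \<xi>" "support \<alpha>"] that(2) show "w \<circ> \<v> i \<in> ?W"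
      by (auto simp: app_ops pivot_endo.rep_eq)
  qed
  have v: "\<v> 0 \<in> ?W" "\<v> 1 \<in> ?W"
    using H_pmon[of 0 "{}" "{}"] H_pmon[of 1 "{}" "{}"]
    by (simp_all add: admissible_def endo.pmon_def pivot_endo.rep_eq)
  \<comment> \<open>So far only right multiplication by the generators is known to preserve
    \<open>?W\<close>. The operators in \<open>?W\<close> with this property form a subalgebra,
    which therefore contains \<open>\<A>\<close>.\<close>
  have "subalgebra {f \<in> ?W. \<forall>w\<in>?W. w \<circ> f \<in> ?W}"
    unfolding subalgebra_def Op.subspace_def
  proof (intro conjI ballI allI)
    fix f g assume "f \<in> {f \<in> ?W. \<forall>w\<in>?W. w \<circ> f \<in> ?W}" "g \<in> {f \<in> ?W. \<forall>w\<in>?W. w \<circ> f \<in> ?W}"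
    then show "f \<circ> g \<in> {f \<in> ?W. \<forall>w\<in>?W. w \<circ> f \<in> ?W}"
      by (simp flip: comp_assoc)
  qed (use End in \<open>auto simp: End\<Lambda>_comp subset_iff Op.span_zero intro: Op.span_add Op.span_scale\<close>)
  then have "\<A> \<subseteq> {f \<in> ?W. \<forall>w\<in>?W. w \<circ> f \<in> ?W}"
    unfolding pivot_algebra_def Alg_def using v right by (intro hull_minimal) auto
  then show ?thesis
    by blast
qed

theorem monomials_subset_pivot_algebra: "monomial_op ` \<B> \<subseteq> (\<A> :: 'k::field operator set)"
proof -
  have "subalgebra (\<A> :: 'k operator set)"
    by (rule subalgebra_pivot_algebra)
  note sub = this[unfolded subalgebra_def]
  interpret pivot_subring "\<X> :: nat \<Rightarrow> 'k endo" \<V> "{f. app f \<in> \<A>}"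
    by standard (use sub subalgebra_pivot_algebra(2,3) in
      \<open>auto simp: app_plus app_uminus app_ops pivot_endo.rep_eq intro: Op.subspace_add Op.subspace_neg\<close>)
  show ?thesis
  proof (rule image_subsetI)
    fix m assume "m \<in> \<B>"
    then show "monomial_op m \<in> (\<A> :: 'k operator set)"
      using admissible_in_A by (cases m) (simp add: basis_monomials_iff monomial_op_eq del: monomial_op.simps)
  qed
qed

theorem theorem9p1:
  shows
    "(CHAR('k::field) \<noteq> 2 \<longrightarrow>
        basis_family (monomial_op :: monomial \<Rightarrow> 'k operator) \<B> \<A>) \<and>
     (CHAR('k) = 2 \<longrightarrow>
        (\<A> :: 'k operator set) \<subseteq> Op.span (monomial_op ` \<B>)) \<and>
     lin_indep_family (monomial_op :: monomial \<Rightarrow> 'k operator)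
        {(n, \<xi>, \<alpha>) \<in> \<B>. n = 0 \<or> \<xi> (n - 1) = 0} \<and>
     (monomial_op :: monomial \<Rightarrow> 'k operator) `
        {(n, \<xi>, \<alpha>) \<in> \<B>. n = 0 \<or> \<xi> (n - 1) = 0} \<subseteq> \<A>"
proof -
  have codes: "\<B> \<subseteq> codes"
    by (auto simp: basis_monomials_iff)
  have "Op.span (monomial_op ` \<B>) = (\<A> :: 'k operator set)"
    using pivot_algebra_subset_span monomials_subset_pivot_algebra subalgebra_pivot_algebra(1)
    by (intro equalityI Op.span_minimal) (auto simp: subalgebra_def)
  with codes have "basis_family (monomial_op :: monomial \<Rightarrow> 'k operator) \<B> \<A>"
    by (simp add: basis_family_def lin_indep_monomials)
  moreover have "lin_indep_family (monomial_op :: monomial \<Rightarrow> 'k operator)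
      {(n, \<xi>, \<alpha>) \<in> \<B>. n = 0 \<or> \<xi> (n - 1) = 0}"
    using codes by (intro lin_indep_monomials) auto
  moreover have "(monomial_op :: monomial \<Rightarrow> 'k operator) `
      {(n, \<xi>, \<alpha>) \<in> \<B>. n = 0 \<or> \<xi> (n - 1) = 0} \<subseteq> \<A>"
    using monomials_subset_pivot_algebra by (rule order_trans[rotated]) auto
  ultimately show ?thesis
    using pivot_algebra_subset_span by blast
qed

end
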